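(* Let $q\in(-1,1)$, let $\mathcal{H}$ be a real Hilbert space, and let $f,g\in\mathcal{H}$ with $\langle f,g\rangle=0$ and $\|f\|=\|g\|=1$. Let $G_f$ and $G_g$ be two $q$-independent random variables in $(\mathcal{A},\mathbb{E})$ with $\mathbb{E}(G_f)=\mathbb{E}(G_g)=0$, $\mathbb{E}(G_f^2)=\|f\|^2=1$, $\mathbb{E}(G_g^2)=\|g\|^2=1$, and $R^q_k(G_g)=R^q_k(G_f)$ for all integers $k\ge1$ (i.e. $G_f$ and $G_g$ have the same distribution). Then $$\mathbb{E}\big((G_f-G_g)(G_f+G_g)(G_f-G_g)(G_f+G_g)^n\big)=2q\,\mathbb{E}\big((G_f+G_g)^{n+1}\big)\quad\text{for all } n\ge0$$ if and only if $G_f$ and $G_g$ are $q$-Gaussian random variables.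
   Context: $\mathcal{A}$ is a von Neumann algebra generated by bounded self-adjoint operators (including $G_f,G_g$), and $\mathbb{E}:\mathcal{A}\to\mathbb{C}$ is a state: a unital, positive, faithful linear functional, not necessarily tracial. Random variables are self-adjoint elements of $\mathcal{A}$. Restricted crossings: let $P_n$ be the set of all partitions of $\{1,\dots,n\}$. For a block $B$ of $\sigma\in P_n$ and $i\in B$ not the first (smallest) element of $B$, put $p(i)=\max\{j\in B: j<i\}$. For two distinct blocks $B,C$, $$rc(B,C)=|\{(i,j): i\in B,\ j\in C,\ p(i)<p(j)<i<j\}|+|\{(i,j): i\in C,\ j\in B,\ p(i)<p(j)<i<j\}|$$ (only $i,j$ for which $p(i),p(j)$ are defined are considered), and $rc(\sigma)=\sum_{i<j}rc(B_i,B_j)$ for $\sigma=\{B_1,\dots,B_k\}$. $q$-cumulants: the multilinear functionals $R^q_k$ ($k\ge1$) determined recursively by $\mathbb{E}(A_1\cdots A_n)=\sum_{\sigma\in P_n}q^{rc(\sigma)}\prod_{B\in\sigma}R^q_{|B|}(A_i:i\in B)$, the arguments of each cumulant being listed in increasing order of index. Write $R^q_k(A)=R^q_k(A,\dots,A)$. Random variables $A_1,\dots,A_n$ are $q$-independent if $R^q_k(Y_1,\dots,Y_k)=0$ for every $k$ and every non-constant choice of $Y_1,\dots,Y_k\in\{A_1,\dots,A_n\}$. A family of self-adjoint operators $G_h$, $h$ in some set of vectors of $\mathcal{H}$ (here $h\in\{f,g\}$), is called $q$-Gaussian (with respect to $\mathbb{E}$) if for all $n\ge1$ and all $f_1,\dots,f_n$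 in this set $$\mathbb{E}(G_{f_1}\cdots G_{f_n})=\begin{cases}\displaystyle\sum_{\sigma\in P_2(n)}q^{rc(\sigma)}\prod_{\{i,j\}\in\sigma}\langle f_i,f_j\rangle & n\text{ even},\\ 0 & n\text{ odd},\end{cases}$$ where $P_2(n)$ is the set of partitions of $\{1,\dots,n\}$ into blocks of size $2$. *)

theory Defs
  imports "HOL-Analysis.Analysis" "HOL-Library.Disjoint_Sets"
begin

section \<open>Bounded operators on a complex Hilbert space\<close>

text \<open>
  A complex Hilbert space is a real Hilbert space together with a complex scalar multiplication and
  a sesquilinear form (conjugate-linear in the first argument) whose real part is the real inner
  product. Positive definiteness and \<open>norm x = sqrt (Re (cinner x x))\<close> are inherited from
  \<^class>\<open>real_inner\<close>, as \<open>cinner x x\<close> is real by conjugate symmetry.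
\<close>

class chilbert_space = real_inner + complete_space +
  fixes scaleC :: "complex \<Rightarrow> 'a \<Rightarrow> 'a"  (infixr "*\<^sub>C" 75)
    and cinner :: "'a \<Rightarrow> 'a \<Rightarrow> complex"
  assumes scaleC_add_right: "c *\<^sub>C (x + y) = c *\<^sub>C x + c *\<^sub>C y"
    and scaleC_add_left: "(c + d) *\<^sub>C x = c *\<^sub>C x + d *\<^sub>C x"
    and scaleC_scaleC: "c *\<^sub>C (d *\<^sub>C x) = (c * d) *\<^sub>C x"
    and scaleR_scaleC: "r *\<^sub>R x = complex_of_real r *\<^sub>C x"
    and cinner_commute: "cinner x y = cnj (cinner y x)"
    and cinner_add_right: "cinner x (y + z) = cinner x y + cinner x z"
    and cinner_scaleC_right: "cinner x (c *\<^sub>C y) = c * cinner x y"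
    and inner_eq_Re_cinner: "inner x y = Re (cinner x y)"

lemma cinner_scaleC_left: "cinner (c *\<^sub>C x) y = cnj c * cinner x y"
  by (metis cinner_commute cinner_scaleC_right complex_cnj_mult)

lemma cinner_self: "cinner x x = complex_of_real ((norm x)\<^sup>2)"
proof (rule complex_eqI)
  show "Re (cinner x x) = Re (complex_of_real ((norm x)\<^sup>2))"
    by (simp add: power2_norm_eq_inner inner_eq_Re_cinner)
  have "Im (cinner x x) = - Im (cinner x x)"
    by (metis cinner_commute cnj.simps(2))
  then show "Im (cinner x x) = Im (complex_of_real ((norm x)\<^sup>2))"
    by simp
qed

lemma norm_scaleC: "norm (c *\<^sub>C x) = cmod c * norm x"
proof -
  have "complex_of_real ((norm (c *\<^sub>C x))\<^sup>2) = cnj c * (c * complex_of_real ((norm x)\<^sup>2))"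
    by (simp only: cinner_self [symmetric] cinner_scaleC_left cinner_scaleC_right ac_simps)
  also have "\<dots> = (c * cnj c) * complex_of_real ((norm x)\<^sup>2)"
    by (simp only: ac_simps)
  also have "\<dots> = complex_of_real ((cmod c * norm x)\<^sup>2)"
    by (simp only: complex_norm_square [symmetric] power_mult_distrib of_real_mult of_real_power)
  finally have "(norm (c *\<^sub>C x))\<^sup>2 = (cmod c * norm x)\<^sup>2"
    by (simp only: of_real_eq_iff)
  then show ?thesis
    by (simp add: power2_eq_iff_nonneg)
qed

lemma bounded_linear_scaleC: "bounded_linear ((*\<^sub>C) c)"
proof (rule bounded_linear_intro)
  show "c *\<^sub>C (r *\<^sub>R x) = r *\<^sub>R (c *\<^sub>C x)" for r x
    by (simp add: scaleR_scaleC scaleC_scaleC mult.commute)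
  show "norm (c *\<^sub>C x) \<le> norm x * cmod c" for x
    by (simp add: norm_scaleC mult.commute)
qed (rule scaleC_add_right)

text \<open>
  Elements of \<open>'k \<Rightarrow>\<^sub>L 'k\<close> are bounded and real-linear; the operators on the complex Hilbert space are
  those which commute with complex scalars.
\<close>

definition clinear_op :: "('k::chilbert_space \<Rightarrow>\<^sub>L 'k) \<Rightarrow> bool" where
  "clinear_op A \<longleftrightarrow> (\<forall>c x. A (c *\<^sub>C x) = c *\<^sub>C A x)"

definition scale_op :: "complex \<Rightarrow> ('k::chilbert_space \<Rightarrow>\<^sub>L 'k) \<Rightarrow> ('k \<Rightarrow>\<^sub>L 'k)" where
  "scale_op c A = Blinfun (\<lambda>x. c *\<^sub>C A x)"

lemma scale_op_apply [simp]: "scale_op c A x = c *\<^sub>C A x"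
  unfolding scale_op_def
  by (subst bounded_linear_Blinfun_apply)
     (auto intro: bounded_linear_compose [OF bounded_linear_scaleC] blinfun.bounded_linear_right)

text \<open>The adjoint exists by the Riesz representation theorem; uniqueness is proved below.\<close>

definition adj_op :: "('k::chilbert_space \<Rightarrow>\<^sub>L 'k) \<Rightarrow> ('k \<Rightarrow>\<^sub>L 'k)" where
  "adj_op A = (THE B :: 'k \<Rightarrow>\<^sub>L 'k. \<forall>x y. cinner (A x) y = cinner x (B y))"

lemma adj_op_eqI:
  fixes A B :: "'k::chilbert_space \<Rightarrow>\<^sub>L 'k"
  assumes "\<And>x y. cinner (A x) y = cinner x (B y)"
  shows "adj_op A = B"
  unfolding adj_op_def
proof (rule the_equality)
  fix C :: "'k \<Rightarrow>\<^sub>L 'k"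
  assume C: "\<forall>x y. cinner (A x) y = cinner x (C y)"
  have "inner x (C y) = inner x (B y)" for x y
    using C assms by (metis inner_eq_Re_cinner)
  then show "C = B"
    by (intro blinfun_eqI) (metis vector_eq_rdot inner_commute)
qed (use assms in blast)

definition self_adjoint :: "('k::chilbert_space \<Rightarrow>\<^sub>L 'k) \<Rightarrow> bool" where
  "self_adjoint A \<longleftrightarrow> clinear_op A \<and> (\<forall>x y. cinner (A x) y = cinner x (A y))"

section \<open>Von Neumann algebras and states\<close>

definition commutant :: "('k::chilbert_space \<Rightarrow>\<^sub>L 'k) set \<Rightarrow> ('k \<Rightarrow>\<^sub>L 'k) set" where
  "commutant M = {B. clinear_op B \<and> (\<forall>A\<in>M. A o\<^sub>L B = B o\<^sub>L A)}"

definition unital_star_algebra :: "('k::chilbert_space \<Rightarrow>\<^sub>L 'k) set \<Rightarrow> bool" where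
  "unital_star_algebra M \<longleftrightarrow>
     (\<forall>A\<in>M. clinear_op A) \<and> id_blinfun \<in> M \<and>
     (\<forall>A\<in>M. \<forall>B\<in>M. A + B \<in> M) \<and> (\<forall>A\<in>M. \<forall>B\<in>M. A o\<^sub>L B \<in> M) \<and>
     (\<forall>c. \<forall>A\<in>M. scale_op c A \<in> M) \<and> (\<forall>A\<in>M. adj_op A \<in> M)"

definition von_neumann_algebra :: "('k::chilbert_space \<Rightarrow>\<^sub>L 'k) set \<Rightarrow> bool" where
  "von_neumann_algebra M \<longleftrightarrow> unital_star_algebra M \<and> commutant (commutant M) = M"

definition generated_von_neumann_algebra ::
    "('k::chilbert_space \<Rightarrow>\<^sub>L 'k) set \<Rightarrow> ('k \<Rightarrow>\<^sub>L 'k) set" where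
  "generated_von_neumann_algebra S = \<Inter>{M. von_neumann_algebra M \<and> S \<subseteq> M}"

text \<open>
  A unital, positive, faithful linear functional on \<open>M\<close>; neither the trace property nor normality is
  required. Values of \<open>E\<close> outside \<open>M\<close> are irrelevant.
\<close>

definition faithful_state_on ::
    "('k::chilbert_space \<Rightarrow>\<^sub>L 'k) set \<Rightarrow> (('k \<Rightarrow>\<^sub>L 'k) \<Rightarrow> complex) \<Rightarrow> bool" where
  "faithful_state_on M E \<longleftrightarrow>
     (\<forall>A\<in>M. \<forall>B\<in>M. E (A + B) = E A + E B) \<and> (\<forall>c. \<forall>A\<in>M. E (scale_op c A) = c * E A) \<and>
     E id_blinfun = 1 \<and>
     (\<forall>A\<in>M. E (adj_op A o\<^sub>L A) \<in> \<real>\<^sub>\<ge>\<^sub>0) \<and>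
     (\<forall>A\<in>M. E (adj_op A o\<^sub>L A) = 0 \<longrightarrow> A = 0)"

definition op_prod :: "('k::chilbert_space \<Rightarrow>\<^sub>L 'k) list \<Rightarrow> ('k \<Rightarrow>\<^sub>L 'k)" where
  "op_prod As = foldr (o\<^sub>L) As id_blinfun"

definition op_power :: "('k::chilbert_space \<Rightarrow>\<^sub>L 'k) \<Rightarrow> nat \<Rightarrow> ('k \<Rightarrow>\<^sub>L 'k)" where
  "op_power A n = op_prod (replicate n A)"

section \<open>Restricted crossings of set partitions\<close>

definition partitions :: "nat \<Rightarrow> nat set set set" where
  "partitions n = {\<sigma>. partition_on {1..n} \<sigma>}"

definition pair_partitions :: "nat \<Rightarrow> nat set set set" where
  "pair_partitions n = {\<sigma> \<in> partitions n. \<forall>B\<in>\<sigma>. card B = 2}"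

definition pred_in :: "nat set \<Rightarrow> nat \<Rightarrow> nat" where
  "pred_in B i = Max {j \<in> B. j < i}"

definition crossings :: "nat set \<Rightarrow> nat set \<Rightarrow> (nat \<times> nat) set" where
  "crossings B C = {(i, j). i \<in> B \<and> i \<noteq> Min B \<and> j \<in> C \<and> j \<noteq> Min C \<and>
                      pred_in B i < pred_in C j \<and> pred_in C j < i \<and> i < j}"

definition rc_blocks :: "nat set \<Rightarrow> nat set \<Rightarrow> nat" where
  "rc_blocks B C = card (crossings B C) + card (crossings C B)"

text \<open>Each unordered pair of distinct blocks is counted once: blocks are enumerated by their minima.\<close>

definition rc :: "nat set set \<Rightarrow> nat" where
  "rc \<sigma> = (\<Sum>(B, C) \<in> {(B, C). B \<in> \<sigma> \<and> C \<in> \<sigma> \<and> Min B < Min C}. rc_blocks B C)"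

section \<open>\<open>q\<close>-cumulants, \<open>q\<close>-independence and \<open>q\<close>-Gaussian families\<close>

text \<open>The entries of a list at the (1-based) positions in \<open>B\<close>, in increasing order of position.\<close>

definition restrict_list :: "'a list \<Rightarrow> nat set \<Rightarrow> 'a list" where
  "restrict_list xs B = map (\<lambda>i. xs ! (i - 1)) (sorted_list_of_set B)"

lemma partitionsD:
  assumes "\<sigma> \<in> partitions n" "B \<in> \<sigma>"
  shows "B \<subseteq> {1..n}" "finite B" "B \<noteq> {}"
proof -
  show "B \<subseteq> {1..n}" "B \<noteq> {}"
    using assms by (auto simp: partitions_def partition_on_def)
  then show "finite B"
    using finite_subset by blast
qed

lemma finite_partitions: "finite (partitions n)"
proof (rule finite_subset)
  show "partitions n \<subseteq> Pow (Pow {1..n})"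
    by (auto simp: partitions_def partition_on_def)
qed simp

lemma proper_block_card:
  assumes "\<sigma> \<in> partitions n" "\<sigma> \<noteq> {{1..n}}" "B \<in> \<sigma>"
  shows "card B < n"
proof -
  have "B \<noteq> {1..n}"
  proof
    assume B: "B = {1..n}"
    have "C = B" if "C \<in> \<sigma>" for C
    proof (rule ccontr)
      assume "C \<noteq> B"
      then have "C \<inter> B = {}"
        using that assms(1,3) by (auto simp: partitions_def partition_on_def disjoint_def)
      with partitionsD [OF assms(1) that] B show False by blast
    qed
    with assms(2,3) B show False by auto
  qed
  with partitionsD(1) [OF assms(1,3)] have "B \<subset> {1..n}" by blast
  then show ?thesis
    using psubset_card_mono [of "{1..n}" B] by simp
qed

text \<open>
  The moment-cumulant formula, solved for the term of the one-block partition: \<open>R\<^sup>q\<^sub>k(A\<^sub>1, \<dots>, A\<^sub>k)\<close> is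
  \<open>q_cumulant q E [A\<^sub>1, \<dots>, A\<^sub>k]\<close>. The formula itself and its uniqueness are proved below.
\<close>

function q_cumulant ::
    "real \<Rightarrow> (('k::chilbert_space \<Rightarrow>\<^sub>L 'k) \<Rightarrow> complex) \<Rightarrow> ('k \<Rightarrow>\<^sub>L 'k) list \<Rightarrow> complex" where
  "q_cumulant q E As =
     E (op_prod As) -
     (\<Sum>\<sigma> \<in> partitions (length As) - {{{1..length As}}}.
        complex_of_real (q ^ rc \<sigma>) * (\<Prod>B\<in>\<sigma>. q_cumulant q E (restrict_list As B)))"
  by pat_completeness auto
termination
  by (relation "Wellfounded.measure (\<lambda>(q, E, As). length As)")
     (auto simp: restrict_list_def intro: proper_block_card)

declare q_cumulant.simps [simp del]

lemma one_block_partition: "n \<ge> 1 \<Longrightarrow> {{1..n}} \<in> partitions n"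
  by (auto simp: partitions_def partition_on_def)

lemma rc_one_block [simp]: "rc {B} = 0"
proof -
  have "{(B', C). B' \<in> {B} \<and> C \<in> {B} \<and> Min B' < Min C} = {}"
    by auto
  then show ?thesis
    unfolding rc_def by (simp only: sum.empty)
qed

lemma restrict_list_all: "restrict_list xs {1..length xs} = xs"
proof -
  have "sorted_list_of_set {1..length xs} = [1..<Suc (length xs)]"
    by (metis atLeastLessThanSuc_atLeastAtMost sorted_list_of_set_range)
  then show ?thesis
    by (intro nth_equalityI) (simp_all add: restrict_list_def del: upt_Suc)
qed

theorem moment_cumulant:
  assumes "As \<noteq> []"
  shows "E (op_prod As) =
    (\<Sum>\<sigma> \<in> partitions (length As).
       complex_of_real (q ^ rc \<sigma>) * (\<Prod>B\<in>\<sigma>. q_cumulant q E (restrict_list As B)))"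
proof -
  have "{{1..length As}} \<in> partitions (length As)"
    using assms by (intro one_block_partition) (simp add: Suc_le_eq)
  then show ?thesis
    by (subst sum.remove [OF finite_partitions], assumption)
       (simp add: restrict_list_all q_cumulant.simps [of q E As] del: One_nat_def)
qed

theorem q_cumulant_unique:
  assumes R: "\<And>As. As \<noteq> [] \<Longrightarrow> E (op_prod As) =
    (\<Sum>\<sigma> \<in> partitions (length As). complex_of_real (q ^ rc \<sigma>) * (\<Prod>B\<in>\<sigma>. R (restrict_list As B)))"
  shows "As \<noteq> [] \<Longrightarrow> R As = q_cumulant q E As"
proof (induction As rule: length_induct)
  case (1 As)
  let ?n = "length As"
  have one: "{{1..?n}} \<in> partitions ?n"
    using 1(2) by (intro one_block_partition) (simp add: Suc_le_eq)
  have "R As = E (op_prod As) - (\<Sum>\<sigma> \<in> partitions ?n - {{{1..?n}}}.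
      complex_of_real (q ^ rc \<sigma>) * (\<Prod>B\<in>\<sigma>. R (restrict_list As B)))"
    by (subst R [OF 1(2)], subst sum.remove [OF finite_partitions one])
       (simp add: restrict_list_all del: One_nat_def)
  also have "\<dots> = q_cumulant q E As"
  proof (subst q_cumulant.simps, intro arg_cong2 [where f = "(-)"] refl sum.cong
      arg_cong2 [where f = "(*)"] prod.cong)
    fix \<sigma> B
    assume \<sigma>: "\<sigma> \<in> partitions ?n - {{{1..?n}}}" and B: "B \<in> \<sigma>"
    have "length (restrict_list As B) < ?n"
      using \<sigma> B by (auto simp: restrict_list_def intro: proper_block_card)
    moreover have "restrict_list As B \<noteq> []"
      using \<sigma> B partitionsD(2,3) by (auto simp: restrict_list_def)
    ultimately show "R (restrict_list As B) = q_cumulant q E (restrict_list As B)"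
      using 1(1) by blast
  qed
  finally show ?case .
qed

text \<open>
  A choice \<open>X i\<^sub>1, \<dots>, X i\<^sub>k\<close> from the family is non-constant if the indices \<open>i\<^sub>1, \<dots>, i\<^sub>k\<close> are not all
  equal; equality is not tested on the operators, so that no family can be \<open>q\<close>-independent merely
  because its members coincide.
\<close>

definition q_independent ::
    "real \<Rightarrow> (('k::chilbert_space \<Rightarrow>\<^sub>L 'k) \<Rightarrow> complex) \<Rightarrow> ('i \<Rightarrow> 'k \<Rightarrow>\<^sub>L 'k) \<Rightarrow> 'i set \<Rightarrow> bool" where
  "q_independent q E X I \<longleftrightarrow>
     (\<forall>is. set is \<subseteq> I \<and> (\<exists>i\<in>set is. \<exists>j\<in>set is. i \<noteq> j) \<longrightarrow> q_cumulant q E (map X is) = 0)"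

text \<open>A block \<open>{i, j}\<close> of a pair partition contributes the inner product of \<open>h i\<close> and \<open>h j\<close>.\<close>

definition q_gaussian ::
    "real \<Rightarrow> (('k::chilbert_space \<Rightarrow>\<^sub>L 'k) \<Rightarrow> complex) \<Rightarrow>
     ('h::{real_inner, complete_space} \<Rightarrow> 'k \<Rightarrow>\<^sub>L 'k) \<Rightarrow> 'h set \<Rightarrow> bool" where
  "q_gaussian q E G V \<longleftrightarrow>
     (\<forall>v\<in>V. self_adjoint (G v)) \<and>
     (\<forall>n\<ge>1. \<forall>h :: nat \<Rightarrow> 'h. (\<forall>i\<in>{1..n}. h i \<in> V) \<longrightarrow>
        E (op_prod (map (\<lambda>i. G (h i)) [1..<n + 1])) =
        (if even n
         then complex_of_real
                (\<Sum>\<sigma> \<in> pair_partitions n. q ^ rc \<sigma> * (\<Prod>B\<in>\<sigma>. inner (h (Min B)) (h (Max B))))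
         else 0))"

end

theory Submission
  imports Defs
begin

text \<open>
  Put \<open>a = G\<^sub>f - G\<^sub>g\<close>, \<open>b = G\<^sub>f + G\<^sub>g\<close> and \<open>r\<^sub>k = R\<^sup>q\<^sub>k(G\<^sub>f) = R\<^sup>q\<^sub>k(G\<^sub>g)\<close>. By \<open>q\<close>-independence, a block of
  size \<open>k\<close> in the expansion of a mixed moment of \<open>a\<close> and \<open>b\<close> has weight \<open>2 r\<^sub>k\<close> if it contains an even
  number of letters \<open>a\<close>, and \<open>0\<close> otherwise. In the moment of \<open>a b a b\<^sup>n\<close> only partitions with 1 and 3 in
  one block survive. Those in which \<open>{1, 3}\<close> is itself a block contribute \<open>2 q E(b\<^bsup>n+1\<^esup>)\<close>: as \<open>r\<^sub>1 = 0\<close>, the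
  point 2 is not a singleton, so the arc from 1 to 3 is crossed exactly once. Hence the identity says
  that the remaining partitions contribute 0 for every \<open>n\<close>. By induction, if \<open>r\<^sub>3, \<dots>, r\<^bsub>n+2\<^esub>\<close> vanish, the
  remainder is the one-block term \<open>2 r\<^bsub>n+3\<^esub>\<close>, so it amounts to \<open>r\<^sub>k = 0\<close> for all \<open>k \<ge> 3\<close>, which is the
  \<open>q\<close>-Gaussian property.
\<close>

section \<open>Moments of sums and differences of \<open>q\<close>-independent variables\<close>

lemma op_prod_Cons: "op_prod (A # As) = A o\<^sub>L op_prod As"
  by (simp add: op_prod_def)

lemma scale_op_of_real: "scale_op (complex_of_real c) A = c *\<^sub>R A"
  by (rule blinfun_eqI) (simp add: scaleR_scaleC blinfun.scaleR_left)

text \<open>Distributivity, with \<open>W\<close> the set of positions at which \<open>Y\<close> is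
  chosen. In the induction, the position sets for \<open>i # is\<close> are split by whether they
  contain \<open>i\<close>; distinctness makes each choice of factors correspond to exactly one
  \<open>W\<close>.\<close>

lemma op_prod_add_expand:
  fixes X Y :: "'k::chilbert_space \<Rightarrow>\<^sub>L 'k"
  assumes "distinct is"
  shows "op_prod (map (\<lambda>i. X + s i *\<^sub>R Y) is) =
    (\<Sum>W\<in>Pow (set is). (\<Prod>i\<in>W. s i) *\<^sub>R op_prod (map (\<lambda>i. if i \<in> W then Y else X) is))"
  using assms
proof (induction "is")
  case Nil
  then show ?case by simp
next
  case (Cons i "is")
  let ?T = "\<lambda>js W. op_prod (map (\<lambda>i. if i \<in> W then Y else X) js)"
  have i: "i \<notin> set is" using Cons by simp
  have notin: "i \<notin> W" "finite W" if "W \<in> Pow (set is)" for W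
    using that i finite_subset by auto
  have inj: "inj_on (insert i) (Pow (set is))"
    using notin(1) by (intro inj_onI) (metis insert_ident)
  have disj: "Pow (set is) \<inter> insert i ` Pow (set is) = {}"
    using i by auto
  have upd: "map (\<lambda>j. if j \<in> insert i W then Y else X) is = map (\<lambda>j. if j \<in> W then Y else X) is" for W
    using i by (intro map_cong) auto
  have "(\<Sum>W\<in>Pow (set (i # is)). (\<Prod>i\<in>W. s i) *\<^sub>R ?T (i # is) W) =
      (\<Sum>W\<in>Pow (set is). (\<Prod>i\<in>W. s i) *\<^sub>R ?T (i # is) W) +
      (\<Sum>W\<in>Pow (set is). (\<Prod>i\<in>insert i W. s i) *\<^sub>R ?T (i # is) (insert i W))"
    by (simp add: Pow_insert sum.union_disjoint disj sum.reindex [OF inj] del: list.map)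
  also have "\<dots> = (\<Sum>W\<in>Pow (set is). (\<Prod>i\<in>W. s i) *\<^sub>R (X o\<^sub>L ?T is W)) +
      (\<Sum>W\<in>Pow (set is). s i *\<^sub>R (\<Prod>i\<in>W. s i) *\<^sub>R (Y o\<^sub>L ?T is W))"
    using notin by (intro arg_cong2 [where f = "(+)"] sum.cong refl)
      (simp_all add: op_prod_Cons upd del: insert_iff, simp_all)
  also have "\<dots> = (X + s i *\<^sub>R Y) o\<^sub>L (\<Sum>W\<in>Pow (set is). (\<Prod>i\<in>W. s i) *\<^sub>R ?T is W)"
    by (simp add: bounded_bilinear.add_left [OF bounded_bilinear_blinfun_compose]
        bounded_bilinear.scaleR_left [OF bounded_bilinear_blinfun_compose]
        bounded_bilinear.scaleR_right [OF bounded_bilinear_blinfun_compose]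
        bounded_bilinear.sum_right [OF bounded_bilinear_blinfun_compose] scaleR_sum_right
        scaleR_add_right sum.distrib mult.commute)
  also have "\<dots> = op_prod (map (\<lambda>i. X + s i *\<^sub>R Y) (i # is))"
    using Cons by (simp add: op_prod_Cons)
  finally show ?case ..
qed

text \<open>A set \<open>W\<close> that cuts a block contributes 0, so only unions of blocks remain,
  one for each subfamily \<open>T\<close> of \<sigma>. The sum over \<open>T\<close> is the expanded
  product over the blocks, in which 1 stands for a block outside \<open>W\<close> and the product of
  the \<open>s i\<close> for a block inside \<open>W\<close>.\<close>

lemma sum_Pow_partition:
  fixes s :: "'a \<Rightarrow> 'b::comm_ring_1" and c :: "'a set \<Rightarrow> 'b"
  assumes "partition_on A \<sigma>" "finite A"
  shows "(\<Sum>W\<in>Pow A. (\<Prod>i\<in>W. s i) * (\<Prod>B\<in>\<sigma>. if B \<subseteq> W \<or> B \<inter> W = {} then c B else 0)) =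
    (\<Prod>B\<in>\<sigma>. c B * (1 + (\<Prod>i\<in>B. s i)))"
proof -
  have U: "\<Union>\<sigma> = A" and d: "disjoint \<sigma>" and ne: "{} \<notin> \<sigma>"
    using assms by (auto simp: partition_on_def)
  have fin: "finite \<sigma>" and finB: "\<And>B. B \<in> \<sigma> \<Longrightarrow> finite B"
    using assms finite_elements U by (auto intro: finite_subset)
  have dj: "B \<inter> C = {}" if "B \<in> \<sigma>" "C \<in> \<sigma>" "B \<noteq> C" for B C
    using d that by (auto simp: disjoint_def)
  \<comment> \<open>As blocks are nonempty and disjoint, \<open>T\<close> can be read off from its
    union.\<close>
  have sub: "B \<subseteq> \<Union>T \<longleftrightarrow> B \<in> T" and dis: "B \<inter> \<Union>T = {} \<longleftrightarrow> B \<notin> T"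
    if "T \<subseteq> \<sigma>" "B \<in> \<sigma>" for B T
  proof -
    have "B \<noteq> {}" using ne that by auto
    moreover have "B \<inter> C = {}" if "C \<in> T" "B \<notin> T" for C
      using dj [of B C] that \<open>T \<subseteq> \<sigma>\<close> \<open>B \<in> \<sigma>\<close> by auto
    ultimately show "B \<subseteq> \<Union>T \<longleftrightarrow> B \<in> T" "B \<inter> \<Union>T = {} \<longleftrightarrow> B \<notin> T"
      by blast+
  qed
  have inj: "inj_on \<Union> (Pow \<sigma>)"
  proof (rule inj_onI)
    fix T T' assume "T \<in> Pow \<sigma>" "T' \<in> Pow \<sigma>" "\<Union>T = \<Union>T'"
    then have "B \<in> T \<longleftrightarrow> B \<in> T'" if "B \<in> \<sigma>" for B
      using sub [of T B] sub [of T' B] that by simp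
    then show "T = T'"
      using \<open>T \<in> Pow \<sigma>\<close> \<open>T' \<in> Pow \<sigma>\<close> by auto
  qed
  have outside: "\<exists>B\<in>\<sigma>. \<not> (B \<subseteq> W \<or> B \<inter> W = {})" if "W \<in> Pow A - \<Union> ` Pow \<sigma>" for W
  proof (rule ccontr)
    assume "\<not> ?thesis"
    then have cases: "B \<subseteq> W \<or> B \<inter> W = {}" if "B \<in> \<sigma>" for B
      using that by simp
    have "W = \<Union>{B\<in>\<sigma>. B \<subseteq> W}"
    proof
      show "W \<subseteq> \<Union>{B\<in>\<sigma>. B \<subseteq> W}"
      proof
        fix x assume "x \<in> W"
        then obtain B where "B \<in> \<sigma>" "x \<in> B"
          using \<open>W \<in> Pow A - \<Union> ` Pow \<sigma>\<close> U by auto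
        then show "x \<in> \<Union>{B\<in>\<sigma>. B \<subseteq> W}"
          using cases [of B] \<open>x \<in> W\<close> by auto
      qed
    qed auto
    then have "W \<in> \<Union> ` Pow \<sigma>"
      by (rule image_eqI) auto
    with that show False
      by simp
  qed
  have "(\<Sum>W\<in>Pow A. (\<Prod>i\<in>W. s i) * (\<Prod>B\<in>\<sigma>. if B \<subseteq> W \<or> B \<inter> W = {} then c B else 0)) =
      (\<Sum>W\<in>\<Union> ` Pow \<sigma>. (\<Prod>i\<in>W. s i) * (\<Prod>B\<in>\<sigma>. if B \<subseteq> W \<or> B \<inter> W = {} then c B else 0))"
  proof (rule sum.mono_neutral_right)
    show "finite (Pow A)" using assms by simp
    show "\<Union> ` Pow \<sigma> \<subseteq> Pow A" using U by blast
    show "\<forall>W\<in>Pow A - \<Union> ` Pow \<sigma>.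
        (\<Prod>i\<in>W. s i) * (\<Prod>B\<in>\<sigma>. if B \<subseteq> W \<or> B \<inter> W = {} then c B else 0) = 0"
    proof
      fix W assume "W \<in> Pow A - \<Union> ` Pow \<sigma>"
      from outside [OF this] obtain B where "B \<in> \<sigma>" "\<not> (B \<subseteq> W \<or> B \<inter> W = {})"
        by (elim bexE) (rule that)
      then have "(\<Prod>B\<in>\<sigma>. if B \<subseteq> W \<or> B \<inter> W = {} then c B else 0) = 0"
        using fin by (simp add: prod.remove [of \<sigma> B])
      then show "(\<Prod>i\<in>W. s i) * (\<Prod>B\<in>\<sigma>. if B \<subseteq> W \<or> B \<inter> W = {} then c B else 0) = 0"
        by simp
    qed
  qed
  also have "\<dots> = (\<Sum>T\<in>Pow \<sigma>. (\<Prod>i\<in>\<Union>T. s i) *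
      (\<Prod>B\<in>\<sigma>. if B \<subseteq> \<Union>T \<or> B \<inter> \<Union>T = {} then c B else 0))"
    by (simp add: sum.reindex [OF inj])
  also have "\<dots> = (\<Sum>T\<in>Pow \<sigma>. (\<Prod>B\<in>T. \<Prod>i\<in>B. s i) * (\<Prod>B\<in>\<sigma>. c B))"
  proof (intro sum.cong refl arg_cong2 [where f = "(*)"])
    fix T assume T: "T \<in> Pow \<sigma>"
    show "(\<Prod>i\<in>\<Union>T. s i) = (\<Prod>B\<in>T. \<Prod>i\<in>B. s i)"
      using T finB dj by (subst prod.Union_disjoint) (auto simp: subset_iff)
    show "(\<Prod>B\<in>\<sigma>. if B \<subseteq> \<Union>T \<or> B \<inter> \<Union>T = {} then c B else 0) = (\<Prod>B\<in>\<sigma>. c B)"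
      using T sub dis by (intro prod.cong) auto
  qed
  also have "\<dots> = (\<Sum>T\<in>Pow \<sigma>. \<Prod>B\<in>T. \<Prod>i\<in>B. s i) * (\<Prod>B\<in>\<sigma>. c B)"
    by (rule sum_distrib_right [symmetric])
  \<comment> \<open>The sum over all subfamilies is the binomial-type expansion of a product of
    two-term sums.\<close>
  also have "(\<Sum>T\<in>Pow \<sigma>. \<Prod>B\<in>T. \<Prod>i\<in>B. s i) = (\<Prod>B\<in>\<sigma>. (\<Prod>i\<in>B. s i) + 1)"
    using prod_add [OF fin, of "\<lambda>B. \<Prod>i\<in>B. s i" "\<lambda>_. 1"] by simp
  also have "\<dots> * (\<Prod>B\<in>\<sigma>. c B) = (\<Prod>B\<in>\<sigma>. ((\<Prod>i\<in>B. s i) + 1) * c B)"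
    by (rule prod.distrib [symmetric])
  finally show ?thesis
    by (simp only: mult.commute add.commute)
qed

section \<open>Indexed moment-cumulant formula and cumulants of a single variable\<close>

lemma restrict_list_map_upt:
  assumes "B \<subseteq> {1..n}"
  shows "restrict_list (map F [1..<n + 1]) B = map F (sorted_list_of_set B)"
proof -
  have "finite B" using assms finite_subset by blast
  \<comment> \<open>Positions count from 1 and list indices from 0; starting the list at 1 makes the
    two shifts cancel.\<close>
  have "map F [1..<n + 1] ! (i - 1) = F i" if "i \<in> B" for i
  proof -
    have "1 \<le> i" "i \<le> n" using that assms by auto
    then show ?thesis by (simp del: upt_Suc)
  qed
  then show ?thesis
    using \<open>finite B\<close> unfolding restrict_list_def by (intro map_cong) auto
qed

lemma moment_cumulant_upt:
  assumes "n \<ge> 1"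
  shows "E (op_prod (map F [1..<n + 1])) = (\<Sum>\<sigma> \<in> partitions n. complex_of_real (q ^ rc \<sigma>) *
      (\<Prod>B\<in>\<sigma>. q_cumulant q E (map F (sorted_list_of_set B))))"
proof -
  have "map F [1..<n + 1] \<noteq> []" and len: "length (map F [1..<n + 1]) = n"
    using assms by auto
  then have "E (op_prod (map F [1..<n + 1])) = (\<Sum>\<sigma> \<in> partitions n. complex_of_real (q ^ rc \<sigma>) *
      (\<Prod>B\<in>\<sigma>. q_cumulant q E (restrict_list (map F [1..<n + 1]) B)))"
    using moment_cumulant [of "map F [1..<n + 1]" E q] unfolding len by blast
  also have "\<dots> = (\<Sum>\<sigma> \<in> partitions n. complex_of_real (q ^ rc \<sigma>) *
      (\<Prod>B\<in>\<sigma>. q_cumulant q E (map F (sorted_list_of_set B))))"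
    using partitionsD(1) by (intro sum.cong prod.cong arg_cong2 [where f = "(*)"] refl)
      (metis restrict_list_map_upt)
  finally show ?thesis .
qed

lemma op_prod_replicate_upt: "op_prod (replicate n A) = op_prod (map (\<lambda>i. A) [1..<n + 1])"
  by (simp add: map_replicate_const del: upt_Suc)

lemma finite_partition_blocks: "\<sigma> \<in> partitions n \<Longrightarrow> finite \<sigma>"
  using finite_elements [of "{1..n}" \<sigma>] by (simp add: partitions_def)

text \<open>With all arguments equal, the factor of a block depends only on its size. Isolating the
  one-block partition gives a recursion that determines the cumulants from the moments.\<close>

lemma cumulant_replicate:
  assumes "n \<ge> 1"
  shows "q_cumulant q E (replicate n A) = E (op_power A n) -
    (\<Sum>\<sigma> \<in> partitions n - {{{1..n}}}. complex_of_real (q ^ rc \<sigma>) *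
      (\<Prod>B\<in>\<sigma>. q_cumulant q E (replicate (card B) A)))"
proof -
  have "E (op_power A n) = (\<Sum>\<sigma> \<in> partitions n. complex_of_real (q ^ rc \<sigma>) *
      (\<Prod>B\<in>\<sigma>. q_cumulant q E (replicate (card B) A)))"
    unfolding op_power_def op_prod_replicate_upt moment_cumulant_upt [OF assms, where q = q]
    by (simp add: map_replicate_const)
  then show ?thesis
    by (simp add: sum.remove [OF finite_partitions one_block_partition [OF assms]] del: One_nat_def)
qed

lemma obtain_block:
  assumes "\<sigma> \<in> partitions n" "i \<in> {1..n}"
  obtains B where "B \<in> \<sigma>" "i \<in> B"
proof -
  have "\<Union>\<sigma> = {1..n}"
    using assms(1) by (simp add: partitions_def partition_on_def)
  with assms(2) that show thesis
    by (metis UnionE)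
qed

lemma proper_block_card_bounds:
  assumes "\<sigma> \<in> partitions n - {{{1..n}}}" "B \<in> \<sigma>"
  shows "1 \<le> card B" "card B < n"
proof -
  have \<sigma>: "\<sigma> \<in> partitions n" "\<sigma> \<noteq> {{1..n}}"
    using assms(1) by blast+
  show "card B < n"
    by (rule proper_block_card [OF \<sigma> assms(2)])
  show "1 \<le> card B"
    using partitionsD(2,3) [OF \<sigma>(1) assms(2)] by (simp add: Suc_le_eq card_gt_0_iff)
qed

text \<open>A partition of one point other than the one-block partition would have a block of size
  at least 1 and less than 1.\<close>

lemma cumulant_one: "q_cumulant q E [A] = E (op_power A 1)"
proof -
  have "\<sigma> \<notin> partitions 1 - {{{1..1}}}" for \<sigma>
  proof
    assume \<sigma>: "\<sigma> \<in> partitions 1 - {{{1..1}}}"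
    then obtain B where "B \<in> \<sigma>"
      using obtain_block [of \<sigma> 1 1] by auto
    then show False
      using proper_block_card_bounds [OF \<sigma>] by fastforce
  qed
  then have "partitions 1 - {{{1..1}}} = {}"
    by blast
  then have "q_cumulant q E (replicate 1 A) = E (op_power A 1)"
    using cumulant_replicate [of 1 q E A] by (simp only: sum.empty diff_zero order.refl simp_thms)
  then show ?thesis
    by simp
qed

text \<open>Every other partition of two points has a singleton block, whose factor is the mean,
  hence 0.\<close>

lemma cumulant_two:
  assumes "E (op_power A 1) = 0"
  shows "q_cumulant q E [A, A] = E (op_power A 2)"
proof -
  have "complex_of_real (q ^ rc \<sigma>) * (\<Prod>B\<in>\<sigma>. q_cumulant q E (replicate (card B) A)) = 0"
    if \<sigma>: "\<sigma> \<in> partitions 2 - {{{1..2}}}" for \<sigma>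
  proof -
    have p: "\<sigma> \<in> partitions 2"
      using \<sigma> by (rule DiffD1)
    then obtain B where B: "B \<in> \<sigma>"
      by (rule obtain_block [of _ _ 1]) simp
    have "card B = 1"
      using proper_block_card_bounds [OF \<sigma> B] by linarith
    then have "q_cumulant q E (replicate (card B) A) = 0"
      using assms by (simp add: cumulant_one)
    then show ?thesis
      using B finite_partition_blocks [OF p] by (auto simp: prod_zero_iff)
  qed
  then have "q_cumulant q E (replicate 2 A) = E (op_power A 2)"
    by (subst cumulant_replicate) (simp, subst sum.neutral, blast, simp)
  then show ?thesis
    by (simp add: numeral_2_eq_2)
qed

text \<open>Counting the points block by block makes \<open>n\<close> even. The odd case of the
  \<open>q\<close>-Gaussian formula is thereby an empty sum.\<close>

lemma odd_pair_partitions: "odd n \<Longrightarrow> pair_partitions n = {}"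
proof (rule equals0I)
  fix \<sigma> assume "odd n" and \<sigma>: "\<sigma> \<in> pair_partitions n"
  have p: "\<sigma> \<in> partitions n" and two: "\<And>B. B \<in> \<sigma> \<Longrightarrow> card B = 2"
    using \<sigma> by (auto simp: pair_partitions_def)
  have "card (\<Union>\<sigma>) = (\<Sum>B\<in>\<sigma>. card B)"
    using p partitionsD(2) [OF p]
    by (intro card_Union_disjoint) (auto simp: partitions_def partition_on_def disjoint_def pairwise_def disjnt_def)
  moreover have "\<Union>\<sigma> = {1..n}"
    using p by (auto simp: partitions_def partition_on_def)
  ultimately have "n = 2 * card \<sigma>"
    using two by simp
  with \<open>odd n\<close> show False by simp
qed

section \<open>Mixed moments of \<open>q\<close>-independent variables\<close>

lemma cumulant_independent_block:
  assumes ind: "q_independent q E G V"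
    and r: "\<And>v k. v \<in> V \<Longrightarrow> 1 \<le> k \<Longrightarrow> q_cumulant q E (replicate k (G v)) = r k"
    and B: "finite B" "B \<noteq> {}" and h: "h ` B \<subseteq> V"
  shows "q_cumulant q E (map (\<lambda>i. G (h i)) (sorted_list_of_set B)) =
    (if \<exists>v. \<forall>i\<in>B. h i = v then r (card B) else 0)"
proof (cases "\<exists>v. \<forall>i\<in>B. h i = v")
  case True
  then obtain v where v: "\<And>i. i \<in> B \<Longrightarrow> h i = v" by blast
  then have "v \<in> V" using B(2) h by blast
  have "map (\<lambda>i. G (h i)) (sorted_list_of_set B) = map (\<lambda>i. G v) (sorted_list_of_set B)"
    using v B(1) by (intro map_cong) auto
  also have "\<dots> = replicate (card B) (G v)"
    by (simp add: map_replicate_const)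
  finally show ?thesis
    using True r [OF \<open>v \<in> V\<close>, of "card B"] B by (simp add: Suc_le_eq card_gt_0_iff)
next
  case False
  let ?is = "map h (sorted_list_of_set B)"
  have set: "set ?is = h ` B" using B(1) by simp
  obtain i where "i \<in> B" using B(2) by blast
  with False obtain j where "j \<in> B" "h i \<noteq> h j" by metis
  \<comment> \<open>Independence speaks of the labels \<open>h i\<close>, not of the operators, so
    two different labels in the block suffice to kill the cumulant.\<close>
  then have "\<exists>a\<in>set ?is. \<exists>b\<in>set ?is. a \<noteq> b"
    unfolding set using \<open>i \<in> B\<close> by blast
  then have "q_cumulant q E (map G ?is) = 0"
    using ind h set unfolding q_independent_def by metis
  then show ?thesis
    unfolding if_not_P [OF False] by (simp add: comp_def)
qed

lemma moment_independent:
  assumes ind: "q_independent q E G V"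
    and r: "\<And>v k. v \<in> V \<Longrightarrow> 1 \<le> k \<Longrightarrow> q_cumulant q E (replicate k (G v)) = r k"
    and n: "n \<ge> 1" and h: "h ` {1..n} \<subseteq> V"
  shows "E (op_prod (map (\<lambda>i. G (h i)) [1..<n + 1])) =
    (\<Sum>\<sigma> \<in> partitions n. complex_of_real (q ^ rc \<sigma>) *
      (\<Prod>B\<in>\<sigma>. if \<exists>v. \<forall>i\<in>B. h i = v then r (card B) else 0))"
  unfolding moment_cumulant_upt [OF n, where q = q]
proof (intro sum.cong prod.cong arg_cong2 [where f = "(*)"] refl)
  fix \<sigma> B assume "\<sigma> \<in> partitions n" "B \<in> \<sigma>"
  note B = partitionsD [OF this]
  then have "h ` B \<subseteq> V" using h by blast
  then show "q_cumulant q E (map (\<lambda>i. G (h i)) (sorted_list_of_set B)) =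
      (if \<exists>v. \<forall>i\<in>B. h i = v then r (card B) else 0)"
    using B by (intro cumulant_independent_block [OF ind r])
qed

section \<open>Linearity of the state and moments of signed sums\<close>

lemma generated_von_neumann_algebra_closed:
  fixes S :: "('k::chilbert_space \<Rightarrow>\<^sub>L 'k) set"
  defines "M \<equiv> generated_von_neumann_algebra S"
  shows "S \<subseteq> M" "id_blinfun \<in> M"
    "A \<in> M \<Longrightarrow> B \<in> M \<Longrightarrow> A + B \<in> M"
    "A \<in> M \<Longrightarrow> B \<in> M \<Longrightarrow> A o\<^sub>L B \<in> M"
    "A \<in> M \<Longrightarrow> scale_op c A \<in> M"
  unfolding M_def generated_von_neumann_algebra_def von_neumann_algebra_def unital_star_algebra_def
  by blast+

lemma op_prod_in_generated_von_neumann_algebra: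
  assumes "set As \<subseteq> S"
  shows "op_prod As \<in> generated_von_neumann_algebra S"
  using assms
proof (induction As)
  case Nil
  show ?case
    by (simp add: op_prod_def generated_von_neumann_algebra_closed(2))
next
  case (Cons A As)
  then have "A \<in> generated_von_neumann_algebra S"
    using generated_von_neumann_algebra_closed(1) [of S] by auto
  with Cons show ?case
    by (simp add: op_prod_Cons generated_von_neumann_algebra_closed(4))
qed

text \<open>Linearity of \<open>E\<close> is given only on \<open>M\<close>, so membership of the
  partial sums is carried through the induction together with the formula. Real multiples enter as
  complex ones via \<open>scale_op\<close>.\<close>

lemma state_sum:
  assumes M: "M = generated_von_neumann_algebra S" and E: "faithful_state_on M E"
    and "finite I" and "\<And>i. i \<in> I \<Longrightarrow> T i \<in> M"
  shows "(\<Sum>i\<in>I. c i *\<^sub>R T i) \<in> M \<and>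
    E (\<Sum>i\<in>I. c i *\<^sub>R T i) = (\<Sum>i\<in>I. complex_of_real (c i) * E (T i))"
proof -
  have add: "E (A + B) = E A + E B" if "A \<in> M" "B \<in> M" for A B
    using E that by (simp add: faithful_state_on_def)
  have scale: "E (scale_op a A) = a * E A" if "A \<in> M" for a A
    using E that by (simp add: faithful_state_on_def)
  show ?thesis
    using assms(3,4)
  proof (induction I rule: finite_induct)
    case empty
    \<comment> \<open>The zero operator lies in \<open>M\<close> as a multiple of the identity, and
      additivity at \<open>0 + 0\<close> then gives \<open>E 0 = 0\<close>.\<close>
    have "scale_op (complex_of_real 0) id_blinfun \<in> M"
      unfolding M by (intro generated_von_neumann_algebra_closed)
    then have "0 \<in> M"
      unfolding scale_op_of_real by simp
    moreover from this have "E (0 + 0) = E 0 + E 0"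
      by (intro add)
    ultimately show ?case by simp
  next
    case (insert i I)
    have i: "T i \<in> M" and I: "(\<Sum>i\<in>I. c i *\<^sub>R T i) \<in> M"
      and E_I: "E (\<Sum>i\<in>I. c i *\<^sub>R T i) = (\<Sum>i\<in>I. complex_of_real (c i) * E (T i))"
      using insert by auto
    have "c i *\<^sub>R T i \<in> M"
      using i unfolding M scale_op_of_real [symmetric]
      by (intro generated_von_neumann_algebra_closed)
    moreover have "E (c i *\<^sub>R T i) = complex_of_real (c i) * E (T i)"
      using i unfolding scale_op_of_real [symmetric] by (rule scale)
    moreover have "E (c i *\<^sub>R T i + (\<Sum>i\<in>I. c i *\<^sub>R T i)) = E (c i *\<^sub>R T i) + E (\<Sum>i\<in>I. c i *\<^sub>R T i)"
      using \<open>c i *\<^sub>R T i \<in> M\<close> I by (rule add)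
    moreover have "c i *\<^sub>R T i + (\<Sum>i\<in>I. c i *\<^sub>R T i) \<in> M"
      using \<open>c i *\<^sub>R T i \<in> M\<close> I unfolding M by (intro generated_von_neumann_algebra_closed)
    ultimately show ?case
      using insert.hyps E_I by simp
  qed
qed

text \<open>The product is expanded into words in \<open>G f\<close> and \<open>G g\<close>, with
  \<open>W\<close> the positions of \<open>G g\<close>. By independence a word sees only the
  partitions whose blocks lie inside or outside \<open>W\<close>. Exchanging the two sums leaves,
  for each block, the choice of \<open>f\<close> everywhere (1) or of \<open>g\<close> everywhere
  (the product of the signs).\<close>

lemma signed_moment:
  assumes M: "M = generated_von_neumann_algebra S" and E: "faithful_state_on M E"
    and G: "G f \<in> S" "G g \<in> S" and "f \<noteq> g"
    and ind: "q_independent q E G {f, g}"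
    and r: "\<And>v k. v \<in> {f, g} \<Longrightarrow> 1 \<le> k \<Longrightarrow> q_cumulant q E (replicate k (G v)) = r k"
    and n: "n \<ge> 1"
  shows "E (op_prod (map (\<lambda>i. G f + s i *\<^sub>R G g) [1..<n + 1])) =
    (\<Sum>\<sigma> \<in> partitions n. complex_of_real (q ^ rc \<sigma>) *
      (\<Prod>B\<in>\<sigma>. r (card B) * (1 + complex_of_real (\<Prod>i\<in>B. s i))))"
proof -
  let ?word = "\<lambda>W. map (\<lambda>i. if i \<in> W then G g else G f) [1..<n + 1]"
  let ?c = "\<lambda>W B. if B \<subseteq> W \<or> B \<inter> W = {} then r (card B) else 0"
  have set: "set [1..<n + 1] = {1..n}" by auto
  \<comment> \<open>Since \<open>f\<close> and \<open>g\<close> differ, the labels are constant on a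
    block exactly if \<open>W\<close> contains it or misses it.\<close>
  have const: "(\<exists>v. \<forall>i\<in>B. (if i \<in> W then g else f) = v) \<longleftrightarrow> B \<subseteq> W \<or> B \<inter> W = {}" for B W :: "nat set"
  proof
    assume "\<exists>v. \<forall>i\<in>B. (if i \<in> W then g else f) = v"
    then obtain v where v: "\<And>i. i \<in> B \<Longrightarrow> (if i \<in> W then g else f) = v" by blast
    have "i \<in> W \<longleftrightarrow> v = g" if "i \<in> B" for i
      using v [OF that] \<open>f \<noteq> g\<close> by (cases "i \<in> W") simp_all
    then show "B \<subseteq> W \<or> B \<inter> W = {}"
      by (cases "v = g") auto
  next
    assume "B \<subseteq> W \<or> B \<inter> W = {}"
    then show "\<exists>v. \<forall>i\<in>B. (if i \<in> W then g else f) = v"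
    proof
      assume "B \<subseteq> W"
      then show ?thesis by (intro exI [of _ g]) auto
    next
      assume "B \<inter> W = {}"
      then show ?thesis by (intro exI [of _ f]) auto
    qed
  qed
  have word: "E (op_prod (?word W)) =
      (\<Sum>\<sigma> \<in> partitions n. complex_of_real (q ^ rc \<sigma>) * (\<Prod>B\<in>\<sigma>. ?c W B))" for W
  proof -
    have "?word W = map (\<lambda>i. G (if i \<in> W then g else f)) [1..<n + 1]"
      by (intro map_cong) auto
    moreover have "(\<lambda>i. if i \<in> W then g else f) ` {1..n} \<subseteq> {f, g}"
      by auto
    note moment_independent [OF ind r n this, unfolded const]
    ultimately show ?thesis
      by (simp only:)
  qed
  have mem: "op_prod (?word W) \<in> M" for W
    unfolding M using G by (intro op_prod_in_generated_von_neumann_algebra) auto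
  have "E (op_prod (map (\<lambda>i. G f + s i *\<^sub>R G g) [1..<n + 1])) =
      (\<Sum>W\<in>Pow {1..n}. complex_of_real (\<Prod>i\<in>W. s i) * E (op_prod (?word W)))"
    unfolding op_prod_add_expand [OF distinct_upt] set
    by (rule conjunct2 [OF state_sum [OF M E _ mem]]) simp
  also have "\<dots> = (\<Sum>W\<in>Pow {1..n}. \<Sum>\<sigma> \<in> partitions n. complex_of_real (q ^ rc \<sigma>) *
      ((\<Prod>i\<in>W. complex_of_real (s i)) * (\<Prod>B\<in>\<sigma>. ?c W B)))"
    unfolding word sum_distrib_left of_real_prod by (simp only: mult.left_commute)
  also have "\<dots> = (\<Sum>\<sigma> \<in> partitions n. complex_of_real (q ^ rc \<sigma>) *
      (\<Sum>W\<in>Pow {1..n}. (\<Prod>i\<in>W. complex_of_real (s i)) * (\<Prod>B\<in>\<sigma>. ?c W B)))"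
    by (subst sum.swap) (simp only: sum_distrib_left)
  also have "\<dots> = (\<Sum>\<sigma> \<in> partitions n. complex_of_real (q ^ rc \<sigma>) *
      (\<Prod>B\<in>\<sigma>. r (card B) * (1 + complex_of_real (\<Prod>i\<in>B. s i))))"
  proof (intro sum.cong arg_cong2 [where f = "(*)"] refl)
    fix \<sigma> assume "\<sigma> \<in> partitions n"
    then have "partition_on {1..n} \<sigma>" by (simp add: partitions_def)
    then show "(\<Sum>W\<in>Pow {1..n}. (\<Prod>i\<in>W. complex_of_real (s i)) * (\<Prod>B\<in>\<sigma>. ?c W B)) =
        (\<Prod>B\<in>\<sigma>. r (card B) * (1 + complex_of_real (\<Prod>i\<in>B. s i)))"
      using sum_Pow_partition [of "{1..n}" \<sigma> "\<lambda>i. complex_of_real (s i)" "\<lambda>B. r (card B)"] by simp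
  qed
  finally show ?thesis .
qed

section \<open>Inserting the block \<open>{1, 3}\<close>\<close>

lemma Min_in_predecessors:
  fixes B :: "nat set"
  assumes "finite B" "i \<in> B" "i \<noteq> Min B"
  shows "Min B \<in> {j \<in> B. j < i}"
proof -
  have "B \<noteq> {}" using assms(2) by blast
  then show ?thesis
    using assms Min_in [of B] Min_le [of B i] by (simp add: less_le)
qed

text \<open>Away from the minimum of \<open>B\<close> the set of smaller elements is nonempty, so
  the \<open>Max\<close> in \<open>pred_in\<close> is attained; at the minimum its value would be
  unspecified.\<close>

lemma pred_in_mem: "finite B \<Longrightarrow> i \<in> B \<Longrightarrow> i \<noteq> Min B \<Longrightarrow> pred_in B i \<in> {j \<in> B. j < i}"
  unfolding pred_in_def using Min_in_predecessors by (intro Max_in) auto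

lemma inj_image:
  assumes "inj f"
  shows "inj ((`) f)"
  using assms by (intro injI) (simp add: inj_image_eq_iff)

lemma pred_in_image:
  fixes \<phi> :: "nat \<Rightarrow> nat"
  assumes \<phi>: "strict_mono \<phi>" and B: "finite B" "i \<in> B" "i \<noteq> Min B"
  shows "pred_in (\<phi> ` B) (\<phi> i) = \<phi> (pred_in B i)"
proof -
  have ne: "{j \<in> B. j < i} \<noteq> {}"
    using Min_in_predecessors [OF B] by blast
  have "{j \<in> \<phi> ` B. j < \<phi> i} = \<phi> ` {j \<in> B. j < i}"
    using strict_mono_less [OF \<phi>] by auto
  then show ?thesis
    unfolding pred_in_def
    using mono_Max_commute [OF strict_mono_mono [OF \<phi>], of "{j \<in> B. j < i}"] B(1) ne by simp
qed

lemma Min_image_strict_mono: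
  fixes \<phi> :: "nat \<Rightarrow> nat"
  assumes "strict_mono \<phi>" "finite B" "B \<noteq> {}"
  shows "Min (\<phi> ` B) = \<phi> (Min B)"
  using mono_Min_commute [OF strict_mono_mono [OF assms(1)] assms(2,3)] by simp

text \<open>Crossings are defined by order comparisons between points and their predecessors, which
  a strictly increasing map preserves and reflects.\<close>

lemma crossings_image:
  fixes \<phi> :: "nat \<Rightarrow> nat"
  assumes \<phi>: "strict_mono \<phi>" and B: "finite B" "B \<noteq> {}" and C: "finite C" "C \<noteq> {}"
  shows "crossings (\<phi> ` B) (\<phi> ` C) = map_prod \<phi> \<phi> ` crossings B C"
proof -
  note eq = strict_mono_eq [OF \<phi>] and less = strict_mono_less [OF \<phi>]
  note simps = Min_image_strict_mono [OF \<phi> B] Min_image_strict_mono [OF \<phi> C]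
    pred_in_image [OF \<phi> B(1)] pred_in_image [OF \<phi> C(1)] eq less
  have iff: "(\<phi> i, \<phi> j) \<in> crossings (\<phi> ` B) (\<phi> ` C) \<longleftrightarrow> (i, j) \<in> crossings B C"
    if "i \<in> B" "j \<in> C" for i j
  \<comment> \<open>At a minimum \<open>pred_in\<close> is unspecified and cannot be transported;
    such pairs lie in neither set.\<close>
  proof (cases "i \<noteq> Min B \<and> j \<noteq> Min C")
    case True
    then show ?thesis
      using that unfolding crossings_def by (simp add: simps)
  next
    case False
    then show ?thesis
      unfolding crossings_def by (auto simp: simps)
  qed
  show ?thesis
  proof (rule set_eqI, rule iffI)
    fix x assume x: "x \<in> crossings (\<phi> ` B) (\<phi> ` C)"
    then obtain i j where "x = (\<phi> i, \<phi> j)" "i \<in> B" "j \<in> C"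
      unfolding crossings_def by auto
    with x iff show "x \<in> map_prod \<phi> \<phi> ` crossings B C"
      by (intro image_eqI [of _ _ "(i, j)"]) auto
  next
    fix x assume "x \<in> map_prod \<phi> \<phi> ` crossings B C"
    then obtain i j where x: "x = (\<phi> i, \<phi> j)" and ij: "(i, j) \<in> crossings B C"
      by auto
    then have "i \<in> B" "j \<in> C"
      unfolding crossings_def by auto
    then show "x \<in> crossings (\<phi> ` B) (\<phi> ` C)"
      using iff x ij by simp
  qed
qed

lemma rc_blocks_image:
  fixes \<phi> :: "nat \<Rightarrow> nat"
  assumes \<phi>: "strict_mono \<phi>" and B: "finite B" "B \<noteq> {}" and C: "finite C" "C \<noteq> {}"
  shows "rc_blocks (\<phi> ` B) (\<phi> ` C) = rc_blocks B C"
proof -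
  have "inj (map_prod \<phi> \<phi>)"
    using strict_mono_imp_inj_on [OF \<phi>] by (simp add: prod.inj_map)
  then have "card (map_prod \<phi> \<phi> ` X) = card X" for X
    by (rule card_image [OF inj_on_subset [OF _ subset_UNIV]])
  then show ?thesis
    by (simp add: rc_blocks_def crossings_image [OF \<phi> B C] crossings_image [OF \<phi> C B])
qed

text \<open>A strictly increasing relabelling keeps the order of the block minima, hence the pairs
  of blocks that are summed over, and the crossings of each pair.\<close>

lemma rc_image:
  fixes \<phi> :: "nat \<Rightarrow> nat"
  assumes \<phi>: "strict_mono \<phi>" and \<sigma>: "\<And>B. B \<in> \<sigma> \<Longrightarrow> finite B \<and> B \<noteq> {}"
  shows "rc ((`) \<phi> ` \<sigma>) = rc \<sigma>"
proof -
  let ?P = "\<lambda>\<sigma>. {(B, C). B \<in> \<sigma> \<and> C \<in> \<sigma> \<and> Min B < Min C}"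
  let ?\<Phi> = "map_prod ((`) \<phi>) ((`) \<phi>)"
  have less: "Min (\<phi> ` B) < Min (\<phi> ` C) \<longleftrightarrow> Min B < Min C" if "B \<in> \<sigma>" "C \<in> \<sigma>" for B C
    using \<sigma> [OF that(1)] \<sigma> [OF that(2)]
    by (simp add: Min_image_strict_mono [OF \<phi>] strict_mono_less [OF \<phi>])
  have "inj ((`) \<phi>)"
    by (intro inj_image strict_mono_imp_inj_on \<phi>)
  from this this have inj: "inj_on ?\<Phi> (?P \<sigma>)"
    by (rule inj_on_subset [OF prod.inj_map subset_UNIV])
  have img: "?P ((`) \<phi> ` \<sigma>) = ?\<Phi> ` ?P \<sigma>"
  proof (rule set_eqI, rule iffI)
    fix x assume "x \<in> ?P ((`) \<phi> ` \<sigma>)"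
    then obtain B C where "x = (\<phi> ` B, \<phi> ` C)" "B \<in> \<sigma>" "C \<in> \<sigma>" "Min (\<phi> ` B) < Min (\<phi> ` C)"
      by auto
    then show "x \<in> ?\<Phi> ` ?P \<sigma>"
      using less by (intro image_eqI [of _ _ "(B, C)"]) auto
  next
    fix x assume "x \<in> ?\<Phi> ` ?P \<sigma>"
    then obtain B C where "x = (\<phi> ` B, \<phi> ` C)" "B \<in> \<sigma>" "C \<in> \<sigma>" "Min B < Min C"
      by auto
    then show "x \<in> ?P ((`) \<phi> ` \<sigma>)"
      using less [of B C] by simp
  qed
  have "rc ((`) \<phi> ` \<sigma>) = (\<Sum>x\<in>?P \<sigma>. case ?\<Phi> x of (B, C) \<Rightarrow> rc_blocks B C)"
    unfolding rc_def img sum.reindex [OF inj] comp_def ..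
  also have "\<dots> = (\<Sum>(B, C)\<in>?P \<sigma>. rc_blocks (\<phi> ` B) (\<phi> ` C))"
    by (intro sum.cong refl) (simp add: case_prod_unfold)
  also have "\<dots> = rc \<sigma>"
    unfolding rc_def by (intro sum.cong refl) (clarsimp simp: rc_blocks_image [OF \<phi>] \<sigma>)
  finally show ?thesis .
qed

section \<open>Crossings with an inserted first block\<close>

text \<open>Because \<open>D\<close> has the smallest minimum, every new pair of blocks has
  \<open>D\<close> as its first component. The strict inequality also excludes \<open>D\<close> from
  \<tau>.\<close>

lemma rc_insert_first:
  assumes "finite \<tau>" and D: "\<And>C. C \<in> \<tau> \<Longrightarrow> Min D < Min C"
  shows "rc (insert D \<tau>) = (\<Sum>C\<in>\<tau>. rc_blocks D C) + rc \<tau>"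
proof -
  let ?P = "{(B, C). B \<in> \<tau> \<and> C \<in> \<tau> \<and> Min B < Min C}"
  have "D \<notin> \<tau>"
    using D [of D] by auto
  have D': "\<not> Min C < Min D" if "C \<in> \<tau>" for C
    using D [OF that] by simp
  have "{(B, C). B \<in> insert D \<tau> \<and> C \<in> insert D \<tau> \<and> Min B < Min C} = Pair D ` \<tau> \<union> ?P"
    by (auto simp: D D')
  moreover have "Pair D ` \<tau> \<inter> ?P = {}"
    using \<open>D \<notin> \<tau>\<close> by auto
  moreover have "finite ?P"
    by (rule finite_subset [of _ "\<tau> \<times> \<tau>"]) (use assms(1) in auto)
  ultimately have "rc (insert D \<tau>) = (\<Sum>(B, C)\<in>Pair D ` \<tau>. rc_blocks B C) + rc \<tau>"
    unfolding rc_def using assms(1) by (simp add: sum.union_disjoint)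
  then show ?thesis
    by (simp add: sum.reindex inj_on_def)
qed

text \<open>The arc from 1 to 3 can only be crossed by an arc starting at 2.\<close>

lemma rc_blocks_first_third:
  assumes C: "finite C" "C \<noteq> {}" "C \<noteq> {2}" and gap: "\<And>j. j \<in> C \<Longrightarrow> j = 2 \<or> 4 \<le> j"
  shows "rc_blocks {1, 3} C = (if 2 \<in> C then 1 else 0)"
proof -
  have Min13: "Min {1, 3 :: nat} = 1" by simp
  have "{j \<in> {1, 3 :: nat}. j < 3} = {1}" by auto
  then have pred3: "pred_in {1, 3} 3 = 1"
    by (simp add: pred_in_def)
  have pred: "pred_in C j \<in> {i \<in> C. i < j}" if "j \<in> C" "j \<noteq> Min C" for j
    using pred_in_mem [OF C(1) that] .
  \<comment> \<open>In such a pair \<open>j\<close> is 3, so the arc of \<open>C\<close> would have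
    to start before 1, whereas all points of \<open>C\<close> are at least 2.\<close>
  have "crossings C {1, 3} = {}"
  proof (rule equals0I)
    fix x assume "x \<in> crossings C {1, 3}"
    then obtain i where "i \<in> C" "i \<noteq> Min C" "pred_in C i < 1"
      unfolding crossings_def Min13 using pred3 by auto
    then show False
      using pred [of i] gap [of "pred_in C i"] by auto
  qed
  moreover have "crossings {1, 3} C = {3} \<times> {j \<in> C. j \<noteq> Min C \<and> pred_in C j = 2}"
  proof -
    \<comment> \<open>An arc of \<open>C\<close> that starts strictly between 1 and 3 starts at 2,
      and by the gap it ends at 4 or later, beyond 3.\<close>
    have "1 < pred_in C j \<and> pred_in C j < 3 \<and> 3 < j \<longleftrightarrow> pred_in C j = 2"
      if "j \<in> C" "j \<noteq> Min C" for j
      using pred [OF that] gap [of j] gap [of "pred_in C j"] that by auto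
    then show ?thesis
      unfolding crossings_def Min13 using pred3 by auto
  qed
  moreover have "card {j \<in> C. j \<noteq> Min C \<and> pred_in C j = 2} = (if 2 \<in> C then 1 else 0)"
  proof (cases "2 \<in> C")
    case True
    have Min: "Min C = 2"
      using True C gap by (intro Min_eqI) force+
    have C2: "finite (C - {2})" "C - {2} \<noteq> {}"
      using C True by auto
    \<comment> \<open>The point of \<open>C\<close> following 2, which exists as \<open>C\<close> is
      not \<open>{2}\<close>; it is the only point whose predecessor is 2.\<close>
    define j\<^sub>0 where "j\<^sub>0 = Min (C - {2})"
    have j\<^sub>0: "j\<^sub>0 \<in> C" "j\<^sub>0 \<noteq> 2"
      using Min_in [OF C2] by (auto simp: j\<^sub>0_def)
    have le: "j\<^sub>0 \<le> j" if "j \<in> C" "j \<noteq> 2" for j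
      using Min_le [OF C2(1), of j] that by (auto simp: j\<^sub>0_def)
    have "4 \<le> j\<^sub>0" using gap [OF j\<^sub>0(1)] j\<^sub>0(2) by simp
    have "{i \<in> C. i < j\<^sub>0} = {2}"
      using le True \<open>4 \<le> j\<^sub>0\<close> by force
    then have "pred_in C j\<^sub>0 = 2"
      by (simp add: pred_in_def)
    moreover have "j = j\<^sub>0" if "j \<in> C" "j \<noteq> 2" "pred_in C j = 2" for j
    proof (rule ccontr)
      assume "j \<noteq> j\<^sub>0"
      then have "j\<^sub>0 \<in> {i \<in> C. i < j}"
        using le [OF that(1,2)] j\<^sub>0 by auto
      then have "j\<^sub>0 \<le> pred_in C j"
        unfolding pred_in_def using C(1) by (intro Max_ge) auto
      with that \<open>4 \<le> j\<^sub>0\<close> show False by simp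
    qed
    ultimately have "{j \<in> C. j \<noteq> Min C \<and> pred_in C j = 2} = {j\<^sub>0}"
      unfolding Min using j\<^sub>0 by blast
    with True show ?thesis by simp
  next
    case False
    have "{j \<in> C. j \<noteq> Min C \<and> pred_in C j = 2} = {}"
    proof (rule equals0I)
      fix j assume "j \<in> {j \<in> C. j \<noteq> Min C \<and> pred_in C j = 2}"
      with pred [of j] False show False by auto
    qed
    then show ?thesis
      using False by (simp only: card.empty if_False)
  qed
  ultimately show ?thesis
    by (simp only: rc_blocks_def card_cartesian_product) simp
qed

section \<open>The bijection that inserts the block \<open>{1, 3}\<close>\<close>

text \<open>The increasing enumeration of the positive integers other than 1 and 3. The value at 0
  makes the map strictly increasing on all natural numbers.\<close>

definition skip_first_third :: "nat \<Rightarrow> nat" where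
  "skip_first_third i = (if i = 0 then 0 else if i = 1 then 2 else i + 2)"

lemma strict_mono_skip_first_third: "strict_mono skip_first_third"
  by (auto simp: strict_mono_def skip_first_third_def)

lemma image_skip_first_third: "skip_first_third ` {1..n + 1} = {1..n + 3} - {1, 3}"
proof (rule set_eqI, rule iffI)
  fix j assume j: "j \<in> {1..n + 3} - {1, 3}"
  show "j \<in> skip_first_third ` {1..n + 1}"
  proof (cases "j = 2")
    case True
    then show ?thesis
      by (intro image_eqI [of _ _ 1]) (auto simp: skip_first_third_def)
  next
    case False
    with j show ?thesis
      by (intro image_eqI [of _ _ "j - 2"]) (auto simp: skip_first_third_def)
  qed
qed (auto simp: skip_first_third_def split: if_splits)

lemma skip_first_third_gap: "i \<ge> 1 \<Longrightarrow> skip_first_third i = 2 \<or> 4 \<le> skip_first_third i"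
  by (auto simp: skip_first_third_def)

definition insert_first_third :: "nat set set \<Rightarrow> nat set set" where
  "insert_first_third \<tau> = insert {1, 3} ((`) skip_first_third ` \<tau>)"

lemma partition_on_inj_image':
  assumes "partition_on A P" "inj_on f A"
  shows "partition_on (f ` A) ((`) f ` P)"
proof -
  have "{} \<notin> (`) f ` P"
    using partition_onD3 [OF assms(1)] by auto
  then show ?thesis
    using partition_on_inj_image [OF assms] by simp
qed

lemma first_third_notin_image: "{1, 3} \<notin> (`) skip_first_third ` \<tau>"
proof
  assume "{1, 3} \<in> (`) skip_first_third ` \<tau>"
  then have "1 \<in> range skip_first_third" by auto
  then show False by (auto simp: skip_first_third_def split: if_splits)
qed

lemma inj_skip_first_third: "inj skip_first_third"
  by (rule strict_mono_imp_inj_on [OF strict_mono_skip_first_third])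

text \<open>The inverse removes the block \<open>{1, 3}\<close> and closes the gaps. Injectivity
  holds because \<open>{1, 3}\<close> is never a relabelled block: 1 is not a value of
  \<open>skip_first_third\<close>.\<close>

lemma bij_betw_insert_first_third:
  "bij_betw insert_first_third (partitions (n + 1)) {\<sigma> \<in> partitions (n + 3). {1, 3} \<in> \<sigma>}"
proof (rule bij_betwI')
  fix \<tau> \<tau>' :: "nat set set"
  have "inj ((`) ((`) skip_first_third))"
    by (intro inj_image inj_skip_first_third)
  then show "insert_first_third \<tau> = insert_first_third \<tau>' \<longleftrightarrow> \<tau> = \<tau>'"
    unfolding insert_first_third_def
    using first_third_notin_image by (metis insert_ident injD)
next
  fix \<tau> assume "\<tau> \<in> partitions (n + 1)"
  then have \<tau>: "partition_on {1..n + 1} \<tau>"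
    by (simp add: partitions_def)
  have "inj_on skip_first_third {1..n + 1}"
    by (rule inj_on_subset [OF inj_skip_first_third subset_UNIV])
  from partition_on_inj_image' [OF \<tau> this]
  have rest: "partition_on ({1..n + 3} - {1, 3}) ((`) skip_first_third ` \<tau>)"
    unfolding image_skip_first_third .
  have "disjnt {1, 3} (\<Union>((`) skip_first_third ` \<tau>))"
    unfolding partition_onD1 [OF rest, symmetric] by (simp add: disjnt_def)
  with rest have "partition_on {1..n + 3} (insert_first_third \<tau>)"
    unfolding insert_first_third_def by (subst partition_on_insert) auto
  then show "insert_first_third \<tau> \<in> {\<sigma> \<in> partitions (n + 3). {1, 3} \<in> \<sigma>}"
    by (simp add: partitions_def insert_first_third_def)
next
  fix \<sigma> assume "\<sigma> \<in> {\<sigma> \<in> partitions (n + 3). {1, 3} \<in> \<sigma>}"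
  then have p: "partition_on {1..n + 3} \<sigma>" and D: "{1, 3} \<in> \<sigma>"
    by (auto simp: partitions_def)
  let ?\<tau> = "\<sigma> - {{1, 3}}" and ?\<psi> = "inv skip_first_third"
  have ins: "insert {1, 3} ?\<tau> = \<sigma>" using D by blast
  have "disjnt {1, 3} (\<Union>?\<tau>)"
    using disjointD [OF partition_onD2 [OF p] D] by (auto simp: disjnt_iff)
  then have \<tau>: "partition_on (skip_first_third ` {1..n + 1}) ?\<tau>"
    using p ins partition_on_insert [of "{1, 3}" ?\<tau> "{1..n + 3}"]
    unfolding image_skip_first_third by simp
  \<comment> \<open>\<open>inv\<close> is a two-sided inverse only on the image, which is where all
    points of the remaining blocks lie.\<close>
  have inv: "skip_first_third (?\<psi> j) = j" if "j \<in> skip_first_third ` {1..n + 1}" for j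
    using that by (metis f_inv_into_f image_iff rangeI)
  have "inj_on ?\<psi> (skip_first_third ` {1..n + 1})"
    using inv by (metis inj_on_inverseI)
  then have "partition_on (?\<psi> ` skip_first_third ` {1..n + 1}) ((`) ?\<psi> ` ?\<tau>)"
    by (rule partition_on_inj_image' [OF \<tau>])
  moreover have "?\<psi> ` skip_first_third ` {1..n + 1} = {1..n + 1}"
    by (simp add: image_image inv_f_f [OF inj_skip_first_third])
  ultimately have mem: "(`) ?\<psi> ` ?\<tau> \<in> partitions (n + 1)"
    by (simp add: partitions_def)
  have "skip_first_third ` ?\<psi> ` B = B" if "B \<in> ?\<tau>" for B
  proof -
    have "j \<in> skip_first_third ` {1..n + 1}" if "j \<in> B" for j
      using partition_onD1 [OF \<tau>] \<open>B \<in> ?\<tau>\<close> that by blast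
    then have "skip_first_third (?\<psi> j) = j" if "j \<in> B" for j
      using inv that by blast
    then show ?thesis
      by (simp add: image_image)
  qed
  then have "(`) skip_first_third ` (`) ?\<psi> ` ?\<tau> = ?\<tau>"
    unfolding image_image [of "(`) skip_first_third"] by simp
  then have "\<sigma> = insert_first_third ((`) ?\<psi> ` ?\<tau>)"
    unfolding insert_first_third_def using ins by simp
  with mem show "\<exists>\<tau>\<in>partitions (n + 1). \<sigma> = insert_first_third \<tau>"
    by blast
qed

text \<open>Relabelling keeps the crossings inside \<tau>. The new arc is crossed only by the block
  that receives position 2, and exactly once, since excluding \<open>{1}\<close> from \<tau>
  guarantees that this block has a further point.\<close>

lemma rc_insert_first_third:
  assumes \<tau>: "\<tau> \<in> partitions (n + 1)" and single: "{1} \<notin> \<tau>"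
  shows "rc (insert_first_third \<tau>) = Suc (rc \<tau>)"
proof -
  let ?F = "(`) skip_first_third"
  note mono = strict_mono_skip_first_third
  note blocks = partitionsD [OF \<tau>]
  have fin: "finite \<tau>" by (rule finite_partition_blocks [OF \<tau>])
  have inj: "inj ?F"
    by (intro inj_image inj_skip_first_third)
  have gap: "j = 2 \<or> 4 \<le> j" if "B \<in> \<tau>" "j \<in> ?F B" for B j
    using that blocks(1) [OF that(1)] skip_first_third_gap by fastforce
  have two: "2 \<in> ?F B \<longleftrightarrow> 1 \<in> B" for B
    by (auto simp: skip_first_third_def image_iff split: if_splits)
  have crossed: "rc_blocks {1, 3} (?F B) = (if 1 \<in> B then 1 else 0)" if B: "B \<in> \<tau>" for B
  proof -
    have "?F B \<noteq> {2}"
    proof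
      assume "?F B = {2}"
      then have "?F B = ?F {1}" by (simp add: skip_first_third_def)
      then have "B = {1}" using inj by (rule injD [rotated])
      with B single show False by simp
    qed
    then show ?thesis
      using rc_blocks_first_third [of "?F B"] blocks [OF B] gap [OF B] two [of B] by simp
  qed
  obtain B\<^sub>1 where B\<^sub>1: "B\<^sub>1 \<in> \<tau>" "1 \<in> B\<^sub>1"
    using \<tau> by (rule obtain_block [of _ _ 1]) simp
  have "disjoint \<tau>"
    using \<tau> by (simp add: partitions_def partition_on_def)
  have iff: "1 \<in> B \<longleftrightarrow> B = B\<^sub>1" if "B \<in> \<tau>" for B
    using disjointD [OF \<open>disjoint \<tau>\<close> that B\<^sub>1(1)] B\<^sub>1(2) by auto
  have "(\<Sum>B\<in>\<tau>. if 1 \<in> B then 1 else 0 :: nat) = (\<Sum>B\<in>\<tau>. if B = B\<^sub>1 then 1 else 0)"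
    by (intro sum.cong refl) (simp only: iff)
  also have "\<dots> = 1"
    using fin B\<^sub>1 by simp
  finally have "(\<Sum>C\<in>?F ` \<tau>. rc_blocks {1, 3} C) = 1"
    using crossed by (simp add: sum.reindex [OF inj_on_subset [OF inj]])
  moreover have "Min {1, 3} < Min (?F B)" if "B \<in> \<tau>" for B
    using gap [OF that Min_in] blocks [OF that] by fastforce
  then have "rc (insert {1, 3} (?F ` \<tau>)) = (\<Sum>C\<in>?F ` \<tau>. rc_blocks {1, 3} C) + rc (?F ` \<tau>)"
    using fin by (intro rc_insert_first) auto
  moreover have "rc (?F ` \<tau>) = rc \<tau>"
    using blocks by (intro rc_image mono) auto
  ultimately show ?thesis
    by (simp add: insert_first_third_def)
qed

section \<open>The moment identity and vanishing cumulants\<close>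

lemma prod_sign_first_third:
  assumes "finite B"
  shows "(\<Prod>i\<in>B. if i \<in> {1, 3 :: nat} then - 1 else 1 :: real) =
    (if 1 \<in> B then - 1 else 1) * (if 3 \<in> B then - 1 else 1)"
proof -
  have "(\<Prod>i\<in>B. if i \<in> {1, 3 :: nat} then - 1 else 1 :: real) =
      (\<Prod>i\<in>B. (if i = 1 then - 1 else 1) * (if i = 3 then - 1 else 1))"
    by (intro prod.cong) auto
  then show ?thesis
    using assms by (simp add: prod.distrib)
qed

text \<open>If 1 and 3 share a block, every block contains both or neither, so all signs multiply to
  1. Otherwise the block of 1 has sign -1 and its factor \<open>1 + (- 1)\<close> vanishes.\<close>

lemma signed_weights:
  fixes r :: "nat \<Rightarrow> complex"
  assumes \<sigma>: "\<sigma> \<in> partitions (n + 3)"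
  shows "(\<Prod>B\<in>\<sigma>. r (card B) * (1 + complex_of_real (\<Prod>i\<in>B. if i \<in> {1, 3} then - 1 else 1))) =
    (if \<exists>B\<in>\<sigma>. {1, 3} \<subseteq> B then (\<Prod>B\<in>\<sigma>. 2 * r (card B)) else 0)"
proof -
  have sign: "(\<Prod>i\<in>B. if i \<in> {1, 3 :: nat} then - 1 else 1 :: real) =
      (if 1 \<in> B then - 1 else 1) * (if 3 \<in> B then - 1 else 1)" if "B \<in> \<sigma>" for B
    by (rule prod_sign_first_third [OF partitionsD(2) [OF \<sigma> that]])
  have "disjoint \<sigma>"
    using \<sigma> by (simp add: partitions_def partition_on_def)
  note disj = disjointD [OF this]
  show ?thesis
  proof (cases "\<exists>B\<in>\<sigma>. {1, 3} \<subseteq> B")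
    case True
    then obtain B\<^sub>1 where B\<^sub>1: "B\<^sub>1 \<in> \<sigma>" "1 \<in> B\<^sub>1" "3 \<in> B\<^sub>1" by auto
    have "1 \<in> B \<longleftrightarrow> 3 \<in> B" if "B \<in> \<sigma>" for B
      using disj [OF that B\<^sub>1(1)] B\<^sub>1(2,3) by blast
    then have "(\<Prod>i\<in>B. if i \<in> {1, 3 :: nat} then - 1 else 1 :: real) = 1" if "B \<in> \<sigma>" for B
      using that unfolding sign [OF that] by simp
    then have "(\<Prod>B\<in>\<sigma>. r (card B) * (1 + complex_of_real (\<Prod>i\<in>B. if i \<in> {1, 3} then - 1 else 1))) =
        (\<Prod>B\<in>\<sigma>. 2 * r (card B))"
      by (intro prod.cong refl) (simp only: of_real_1, simp)
    then show ?thesis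
      unfolding if_P [OF True] .
  next
    case False
    obtain B\<^sub>1 where B\<^sub>1: "B\<^sub>1 \<in> \<sigma>" "1 \<in> B\<^sub>1"
      using \<sigma> by (rule obtain_block [of _ _ 1]) simp
    then have "3 \<notin> B\<^sub>1" using False by auto
    then have "r (card B\<^sub>1) * (1 + complex_of_real (\<Prod>i\<in>B\<^sub>1. if i \<in> {1, 3} then - 1 else 1)) = 0"
      using B\<^sub>1 unfolding sign [OF B\<^sub>1(1)] by simp
    then have "(\<Prod>B\<in>\<sigma>. r (card B) * (1 + complex_of_real (\<Prod>i\<in>B. if i \<in> {1, 3} then - 1 else 1))) = 0"
      by (intro prod_zero [OF finite_partition_blocks [OF \<sigma>]] bexI [OF _ B\<^sub>1(1)])
    then show ?thesis
      unfolding if_not_P [OF False] .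
  qed
qed

text \<open>Along the bijection, the inserted block contributes the weight
  \<open>2 * r 2 = 2\<close> and its single crossing contributes the factor
  \<open>q\<close>.\<close>

lemma sum_partitions_first_third_block:
  fixes r :: "nat \<Rightarrow> complex"
  assumes r: "r 1 = 0" "r 2 = 1"
  shows "(\<Sum>\<sigma> | \<sigma> \<in> partitions (n + 3) \<and> {1, 3} \<in> \<sigma>.
      complex_of_real (q ^ rc \<sigma>) * (\<Prod>B\<in>\<sigma>. 2 * r (card B))) =
    2 * complex_of_real q *
      (\<Sum>\<tau>\<in>partitions (n + 1). complex_of_real (q ^ rc \<tau>) * (\<Prod>B\<in>\<tau>. 2 * r (card B)))"
  unfolding sum_distrib_left sum.reindex_bij_betw [OF bij_betw_insert_first_third, symmetric]
proof (rule sum.cong [OF refl])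
  fix \<tau> assume \<tau>: "\<tau> \<in> partitions (n + 1)"
  note fin = finite_partition_blocks [OF \<tau>]
  have "inj ((`) skip_first_third)"
    by (intro inj_image inj_skip_first_third)
  then have inj: "inj_on ((`) skip_first_third) \<tau>"
    by (rule inj_on_subset) simp
  have card: "card (skip_first_third ` B) = card B" for B
    by (rule card_image [OF inj_on_subset [OF inj_skip_first_third subset_UNIV]])
  have weight: "(\<Prod>B\<in>insert_first_third \<tau>. 2 * r (card B)) = 2 * (\<Prod>B\<in>\<tau>. 2 * r (card B))"
    unfolding insert_first_third_def
    using fin first_third_notin_image [of \<tau>] r(2)
    by (simp add: prod.reindex [OF inj] card numeral_2_eq_2)
  show "complex_of_real (q ^ rc (insert_first_third \<tau>)) * (\<Prod>B\<in>insert_first_third \<tau>. 2 * r (card B)) =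
      2 * complex_of_real q * (complex_of_real (q ^ rc \<tau>) * (\<Prod>B\<in>\<tau>. 2 * r (card B)))"
  proof (cases "{1} \<in> \<tau>")
    case True
    have "(\<Prod>B\<in>\<tau>. 2 * r (card B)) = 0"
      by (rule prod_zero [OF fin], rule bexI [OF _ True]) (use r(1) in simp)
    then show ?thesis
      by (simp add: weight)
  next
    case False
    then show ?thesis
      by (simp add: weight rc_insert_first_third [OF \<tau>])
  qed
qed

text \<open>These partitions carry the remainder of the moment identity. Proper inclusion forces the
  block of 1 and 3 to have at least three points.\<close>

definition large_first_third :: "nat \<Rightarrow> nat set set set" where
  "large_first_third n = {\<sigma> \<in> partitions (n + 3). \<exists>B\<in>\<sigma>. {1, 3} \<subset> B}"

lemma sum_signed_weights:
  fixes r :: "nat \<Rightarrow> complex"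
  assumes r: "r 1 = 0" "r 2 = 1"
  shows "(\<Sum>\<sigma>\<in>partitions (n + 3). complex_of_real (q ^ rc \<sigma>) *
      (\<Prod>B\<in>\<sigma>. r (card B) * (1 + complex_of_real (\<Prod>i\<in>B. if i \<in> {1, 3} then - 1 else 1)))) =
    2 * complex_of_real q *
      (\<Sum>\<tau>\<in>partitions (n + 1). complex_of_real (q ^ rc \<tau>) * (\<Prod>B\<in>\<tau>. 2 * r (card B))) +
    (\<Sum>\<sigma>\<in>large_first_third n. complex_of_real (q ^ rc \<sigma>) * (\<Prod>B\<in>\<sigma>. 2 * r (card B)))"
proof -
  let ?w = "\<lambda>\<sigma>. complex_of_real (q ^ rc \<sigma>) * (\<Prod>B\<in>\<sigma>. 2 * r (card B))"
  let ?exact = "{\<sigma>. \<sigma> \<in> partitions (n + 3) \<and> {1, 3} \<in> \<sigma>}"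
  have "(\<Sum>\<sigma>\<in>partitions (n + 3). complex_of_real (q ^ rc \<sigma>) *
      (\<Prod>B\<in>\<sigma>. r (card B) * (1 + complex_of_real (\<Prod>i\<in>B. if i \<in> {1, 3} then - 1 else 1)))) =
      (\<Sum>\<sigma>\<in>partitions (n + 3). if \<exists>B\<in>\<sigma>. {1, 3} \<subseteq> B then ?w \<sigma> else 0)"
    by (intro sum.cong refl) (auto simp only: signed_weights mult_zero_right split: if_split)
  also have "\<dots> = (\<Sum>\<sigma> | \<sigma> \<in> partitions (n + 3) \<and> (\<exists>B\<in>\<sigma>. {1, 3} \<subseteq> B). ?w \<sigma>)"
    by (rule sum.inter_filter [symmetric, OF finite_partitions])
  also have "{\<sigma>. \<sigma> \<in> partitions (n + 3) \<and> (\<exists>B\<in>\<sigma>. {1, 3} \<subseteq> B)} = ?exact \<union> large_first_third n"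
    unfolding large_first_third_def psubset_eq by auto
  also have "sum ?w \<dots> = sum ?w ?exact + sum ?w (large_first_third n)"
  proof (rule sum.union_disjoint)
    show "finite ?exact" "finite (large_first_third n)"
      using finite_partitions [of "n + 3"] by (simp_all add: large_first_third_def)
    show "?exact \<inter> large_first_third n = {}"
    proof (rule equals0I)
      fix \<sigma> assume "\<sigma> \<in> ?exact \<inter> large_first_third n"
      then obtain B where "\<sigma> \<in> partitions (n + 3)" "{1, 3} \<in> \<sigma>" "B \<in> \<sigma>" "{1, 3} \<subset> B"
        by (auto simp: large_first_third_def)
      moreover from this have "disjoint \<sigma>"
        by (simp add: partitions_def partition_on_def)
      ultimately have "{1, 3} \<inter> B = {}"
        using disjointD [of \<sigma> "{1, 3}" B] by simp
      with \<open>{1, 3} \<subset> B\<close> show False by auto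
    qed
  qed
  finally show ?thesis
    unfolding sum_partitions_first_third_block [OF r] .
qed

text \<open>The block containing 1 and 3 has at least 3 points, and fewer than \<open>n + 3\<close>
  unless it is everything. Hence the hypothesis kills every term but that of the one-block
  partition, which has no crossings.\<close>

lemma sum_large_first_third:
  fixes r :: "nat \<Rightarrow> complex"
  assumes r: "\<And>k. 3 \<le> k \<Longrightarrow> k < n + 3 \<Longrightarrow> r k = 0"
  shows "(\<Sum>\<sigma>\<in>large_first_third n. complex_of_real (q ^ rc \<sigma>) * (\<Prod>B\<in>\<sigma>. 2 * r (card B))) =
    2 * r (n + 3)"
proof -
  let ?one = "{{1..n + 3}}"
  \<comment> \<open>The point 2 makes the inclusion proper, also for \<open>n = 0\<close>.\<close>
  have "{1, 3} \<subset> {1..n + 3}"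
  proof
    show "{1, 3} \<noteq> {1..n + 3}"
    proof
      assume "{1, 3} = {1..n + 3}"
      moreover have "2 \<in> {1..n + 3}" by simp
      ultimately have "2 \<in> {1, 3 :: nat}" by (simp only:)
      then show False by simp
    qed
  qed auto
  then have one: "?one \<in> large_first_third n"
    using one_block_partition [of "n + 3"] by (simp add: large_first_third_def)
  have fin: "finite (large_first_third n)"
    using finite_partitions [of "n + 3"] by (simp add: large_first_third_def)
  have "complex_of_real (q ^ rc \<sigma>) * (\<Prod>B\<in>\<sigma>. 2 * r (card B)) = 0"
    if \<sigma>: "\<sigma> \<in> large_first_third n - {?one}" for \<sigma>
  proof -
    from \<sigma> obtain B where p: "\<sigma> \<in> partitions (n + 3) - {?one}" and B: "B \<in> \<sigma>" "{1, 3} \<subset> B"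
      by (auto simp: large_first_third_def)
    from p have p': "\<sigma> \<in> partitions (n + 3)" by (rule DiffD1)
    have "card {1, 3 :: nat} < card B"
      by (rule psubset_card_mono [OF partitionsD(2) [OF p' B(1)] B(2)])
    then have "r (card B) = 0"
      using proper_block_card_bounds(2) [OF p B(1)] by (intro r) simp_all
    then have "(\<Prod>B\<in>\<sigma>. 2 * r (card B)) = 0"
      by (intro prod_zero [OF finite_partition_blocks [OF p']] bexI [OF _ B(1)]) simp
    then show ?thesis by simp
  qed
  then have "(\<Sum>\<sigma>\<in>large_first_third n - {?one}.
      complex_of_real (q ^ rc \<sigma>) * (\<Prod>B\<in>\<sigma>. 2 * r (card B))) = 0"
    by (intro sum.neutral ballI)
  then show ?thesis
    unfolding sum.remove [OF fin one] by (simp add: add.commute)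
qed

text \<open>The system is triangular: once the cumulants of orders 3 to \<open>n + 2\<close> vanish,
  the sum for \<open>n\<close> equals \<open>2 * r (n + 3)\<close>. Strong induction then yields one
  cumulant after the other.\<close>

lemma sum_large_first_third_eq_0_iff:
  fixes r :: "nat \<Rightarrow> complex"
  shows "(\<forall>n. (\<Sum>\<sigma>\<in>large_first_third n. complex_of_real (q ^ rc \<sigma>) * (\<Prod>B\<in>\<sigma>. 2 * r (card B))) = 0)
    \<longleftrightarrow> (\<forall>k\<ge>3. r k = 0)"
proof
  assume zero: "\<forall>n. (\<Sum>\<sigma>\<in>large_first_third n.
      complex_of_real (q ^ rc \<sigma>) * (\<Prod>B\<in>\<sigma>. 2 * r (card B))) = 0"
  have "r k = 0" if "3 \<le> k" for k
    using that
  proof (induction k rule: less_induct)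
    case (less k)
    then obtain n where k: "k = n + 3"
      by (metis le_add_diff_inverse2)
    with less.IH show ?case
      using zero sum_large_first_third [of n r q] by simp
  qed
  then show "\<forall>k\<ge>3. r k = 0" by blast
next
  assume "\<forall>k\<ge>3. r k = 0"
  then show "\<forall>n. (\<Sum>\<sigma>\<in>large_first_third n.
      complex_of_real (q ^ rc \<sigma>) * (\<Prod>B\<in>\<sigma>. 2 * r (card B))) = 0"
    by (intro allI, subst sum_large_first_third) simp_all
qed

section \<open>Gaussian moments and the vanishing of higher cumulants\<close>

text \<open>If only the second cumulant survives, the moments are sums over pair partitions, and by
  orthonormality the weight of a pair is the inner product of its labels. Conversely, the moments of
  a single \<open>G v\<close> determine its cumulants recursively, and the Gaussian ones leave
  nothing for order 3 and above.\<close>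

lemma q_gaussian_iff_cumulants:
  assumes V: "\<And>v. v \<in> V \<Longrightarrow> norm v = 1" "\<And>v w. v \<in> V \<Longrightarrow> w \<in> V \<Longrightarrow> v \<noteq> w \<Longrightarrow> inner v w = 0"
    and "V \<noteq> {}" and sa: "\<And>v. v \<in> V \<Longrightarrow> self_adjoint (G v)"
    and ind: "q_independent q E G V"
    and r: "\<And>v k. v \<in> V \<Longrightarrow> 1 \<le> k \<Longrightarrow> q_cumulant q E (replicate k (G v)) = r k"
    and r12: "r 1 = 0" "r 2 = 1"
  shows "q_gaussian q E G V \<longleftrightarrow> (\<forall>k\<ge>3. r k = 0)"
proof
  assume zero: "\<forall>k\<ge>3. r k = 0"
  have "E (op_prod (map (\<lambda>i. G (h i)) [1..<n + 1])) =
      (if even n then complex_of_real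
         (\<Sum>\<sigma>\<in>pair_partitions n. q ^ rc \<sigma> * (\<Prod>B\<in>\<sigma>. inner (h (Min B)) (h (Max B)))) else 0)"
    if n: "1 \<le> n" and h: "\<forall>i\<in>{1..n}. h i \<in> V" for n h
  proof -
    let ?c = "\<lambda>B. if \<exists>v. \<forall>i\<in>B. h i = v then r (card B) else 0"
    have "E (op_prod (map (\<lambda>i. G (h i)) [1..<n + 1])) =
        (\<Sum>\<sigma>\<in>partitions n. complex_of_real (q ^ rc \<sigma>) * (\<Prod>B\<in>\<sigma>. ?c B))"
      using h by (intro moment_independent [OF ind r n]) auto
    also have "\<dots> = (\<Sum>\<sigma>\<in>pair_partitions n. complex_of_real (q ^ rc \<sigma>) * (\<Prod>B\<in>\<sigma>. ?c B))"
    proof (rule sum.mono_neutral_right [OF finite_partitions], force simp: pair_partitions_def, rule ballI)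
      fix \<sigma> assume "\<sigma> \<in> partitions n - pair_partitions n"
      then obtain B where \<sigma>: "\<sigma> \<in> partitions n" and B: "B \<in> \<sigma>" "card B \<noteq> 2"
        by (auto simp: pair_partitions_def)
      have "card B \<noteq> 0"
        using partitionsD(2,3) [OF \<sigma> B(1)] by simp
      then have "card B = 1 \<or> 3 \<le> card B"
        using B(2) by linarith
      then have "?c B = 0"
        using zero r12(1) by auto
      then have "(\<Prod>B\<in>\<sigma>. ?c B) = 0"
        by (intro prod_zero [OF finite_partition_blocks [OF \<sigma>]] bexI [OF _ B(1)])
      then show "complex_of_real (q ^ rc \<sigma>) * (\<Prod>B\<in>\<sigma>. ?c B) = 0"
        by (simp only: mult_zero_right)
    qed
    also have "\<dots> = (\<Sum>\<sigma>\<in>pair_partitions n. complex_of_real (q ^ rc \<sigma>) *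
        (\<Prod>B\<in>\<sigma>. complex_of_real (inner (h (Min B)) (h (Max B)))))"
    proof (intro sum.cong prod.cong arg_cong2 [where f = "(*)"] refl)
      fix \<sigma> B assume "\<sigma> \<in> pair_partitions n" and B: "B \<in> \<sigma>"
      then have \<sigma>: "\<sigma> \<in> partitions n" and "card B = 2"
        by (auto simp: pair_partitions_def)
      then obtain a b where ab: "B = {a, b}" "a \<noteq> b"
        by (auto simp: card_2_iff)
      have "a \<in> {1..n}" "b \<in> {1..n}"
        using partitionsD(1) [OF \<sigma> B] ab by auto
      then have hab: "h a \<in> V" "h b \<in> V"
        using h by auto
      \<comment> \<open>By symmetry of the inner product it is irrelevant which of the two points is
        the smaller one.\<close>
      have "inner (h (Min B)) (h (Max B)) = inner (h a) (h b)"
        unfolding ab by (cases "a < b") (auto simp: min_def max_def inner_commute)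
      also have "\<dots> = (if h a = h b then 1 else 0)"
      proof (cases "h a = h b")
        case True
        then show ?thesis using V(1) [OF hab(1)] by (simp add: norm_eq_1)
      next
        case False
        then show ?thesis using V(2) [OF hab False] by simp
      qed
      finally have inner: "inner (h (Min B)) (h (Max B)) = (if h a = h b then 1 else 0)" .
      have "(\<exists>v. \<forall>i\<in>B. h i = v) \<longleftrightarrow> h a = h b"
        unfolding ab by auto
      then show "?c B = complex_of_real (inner (h (Min B)) (h (Max B)))"
        unfolding inner \<open>card B = 2\<close> r12(2) by simp
    qed
    also have "\<dots> = complex_of_real
         (\<Sum>\<sigma>\<in>pair_partitions n. q ^ rc \<sigma> * (\<Prod>B\<in>\<sigma>. inner (h (Min B)) (h (Max B))))"
      by simp
    finally show ?thesis
      by (cases "even n") (simp_all add: odd_pair_partitions del: upt_Suc of_real_sum)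
  qed
  then show "q_gaussian q E G V"
    using sa unfolding q_gaussian_def by blast
next
  assume gauss: "q_gaussian q E G V"
  have moments: "E (op_prod (map (\<lambda>i. G (h i)) [1..<n + 1])) =
      (if even n then complex_of_real
         (\<Sum>\<sigma>\<in>pair_partitions n. q ^ rc \<sigma> * (\<Prod>B\<in>\<sigma>. inner (h (Min B)) (h (Max B)))) else 0)"
    if "1 \<le> n" "\<forall>i\<in>{1..n}. h i \<in> V" for n h
    using gauss that unfolding q_gaussian_def by blast
  obtain v where v: "v \<in> V" using \<open>V \<noteq> {}\<close> by blast
  have "inner v v = 1"
    using V(1) [OF v] by (simp add: norm_eq_1)
  have "r k = 0" if "3 \<le> k" for k
    using that
  proof (induction k rule: less_induct)
    case (less k)
    then have k: "1 \<le> k" by simp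
    have "E (op_prod (map (\<lambda>i. G v) [1..<k + 1])) =
        (if even k then complex_of_real
           (\<Sum>\<sigma>\<in>pair_partitions k. q ^ rc \<sigma> * (\<Prod>B\<in>\<sigma>. inner v v)) else 0)"
      by (rule moments [OF k, of "\<lambda>_. v"]) (use v in blast)
    then have E_k: "E (op_power (G v) k) = (\<Sum>\<sigma>\<in>pair_partitions k. complex_of_real (q ^ rc \<sigma>))"
      unfolding op_power_def op_prod_replicate_upt \<open>inner v v = 1\<close>
      by (cases "even k") (simp_all add: odd_pair_partitions del: upt_Suc)
    let ?proper = "partitions k - {{{1..k}}}"
    have "(\<Sum>\<sigma>\<in>?proper. complex_of_real (q ^ rc \<sigma>) *
          (\<Prod>B\<in>\<sigma>. q_cumulant q E (replicate (card B) (G v)))) =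
        (\<Sum>\<sigma>\<in>?proper. complex_of_real (q ^ rc \<sigma>) * (\<Prod>B\<in>\<sigma>. r (card B)))"
      using r [OF v] proper_block_card_bounds(1)
      by (intro sum.cong prod.cong arg_cong2 [where f = "(*)"] refl) blast
    \<comment> \<open>A proper partition that is not a pairing has a block of size 1 or of size
      between 3 and \<open>k - 1\<close>, whose cumulant vanishes by \<open>r 1 = 0\<close> or by
      the induction hypothesis.\<close>
    also have "\<dots> = (\<Sum>\<sigma>\<in>pair_partitions k. complex_of_real (q ^ rc \<sigma>) * (\<Prod>B\<in>\<sigma>. r (card B)))"
    proof (rule sum.mono_neutral_right)
      show "finite ?proper" using finite_partitions by simp
      \<comment> \<open>The one-block partition is not a pairing, as \<open>k\<close> is at least
        3.\<close>
      show "pair_partitions k \<subseteq> ?proper"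
        using less.prems by (auto simp: pair_partitions_def)
      show "\<forall>\<sigma>\<in>?proper - pair_partitions k. complex_of_real (q ^ rc \<sigma>) * (\<Prod>B\<in>\<sigma>. r (card B)) = 0"
      proof
        fix \<sigma> assume "\<sigma> \<in> ?proper - pair_partitions k"
        then obtain B where \<sigma>: "\<sigma> \<in> ?proper" and B: "B \<in> \<sigma>" "card B \<noteq> 2"
          by (auto simp: pair_partitions_def)
        have "card B = 1 \<or> 3 \<le> card B \<and> card B < k"
          using proper_block_card_bounds [OF \<sigma> B(1)] B(2) by linarith
        then have "r (card B) = 0"
          using less.IH r12(1) by auto
        then have "(\<Prod>B\<in>\<sigma>. r (card B)) = 0"
          by (intro prod_zero [OF finite_partition_blocks [OF DiffD1 [OF \<sigma>]]] bexI [OF _ B(1)])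
        then show "complex_of_real (q ^ rc \<sigma>) * (\<Prod>B\<in>\<sigma>. r (card B)) = 0"
          by (simp only: mult_zero_right)
      qed
    qed
    also have "\<dots> = (\<Sum>\<sigma>\<in>pair_partitions k. complex_of_real (q ^ rc \<sigma>))"
      using r12(2) by (intro sum.cong refl) (auto simp: pair_partitions_def)
    \<comment> \<open>The pair partitions already account for the whole \<open>k\<close>-th moment,
      so the recursion leaves 0 for the \<open>k\<close>-th cumulant.\<close>
    finally show ?case
      using cumulant_replicate [OF k, of q E "G v"] r [OF v k] E_k by simp
  qed
  then show "\<forall>k\<ge>3. r k = 0" by blast
qed

section \<open>The moment identity characterises \<open>q\<close>-Gaussian variables\<close>

theorem theorem4p4:
  fixes q :: real
    and f g :: "'h::{real_inner, complete_space}"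
    and S \<A> :: "('k::chilbert_space \<Rightarrow>\<^sub>L 'k) set"
    and E :: "('k \<Rightarrow>\<^sub>L 'k) \<Rightarrow> complex"
    and G :: "'h \<Rightarrow> 'k \<Rightarrow>\<^sub>L 'k"
  assumes q: "- 1 < q" "q < 1"
    and fg: "inner f g = 0" "norm f = 1" "norm g = 1"
    and generators: "\<forall>A\<in>S. self_adjoint A" "G f \<in> S" "G g \<in> S"
    and algebra: "\<A> = generated_von_neumann_algebra S"
    and state: "faithful_state_on \<A> E"
    and independent: "q_independent q E G {f, g}"
    and mean: "E (G f) = 0" "E (G g) = 0"
    and variance: "E (op_power (G f) 2) = 1" "E (op_power (G g) 2) = 1"
    and same_distribution:
      "\<forall>k\<ge>1. q_cumulant q E (replicate k (G g)) = q_cumulant q E (replicate k (G f))"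
  shows "(\<forall>n. E ((G f - G g) o\<^sub>L (G f + G g) o\<^sub>L (G f - G g) o\<^sub>L op_power (G f + G g) n) =
              2 * complex_of_real q * E (op_power (G f + G g) (n + 1)))
         \<longleftrightarrow> q_gaussian q E G {f, g}"
proof -
  define r where "r k = q_cumulant q E (replicate k (G f))" for k
  have r: "q_cumulant q E (replicate k (G v)) = r k" if "v \<in> {f, g}" "1 \<le> k" for v k
    using that same_distribution by (auto simp: r_def)
  have "op_power (G f) 1 = G f"
    by (rule blinfun_eqI) (simp add: op_power_def op_prod_def)
  then have r12: "r 1 = 0" "r 2 = 1"
    using mean(1) variance(1) cumulant_one [of q E "G f"] cumulant_two [of E "G f" q]
    by (simp_all add: r_def numeral_2_eq_2)
  have "f \<noteq> g"
    using fg by auto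
  note moment = signed_moment [OF algebra state generators(2,3) \<open>f \<noteq> g\<close> independent r]
  \<comment> \<open>The coefficients of \<open>G g\<close> in the word: the differences stand at
    positions 1 and 3, sums at all others.\<close>
  let ?s = "\<lambda>i::nat. if i \<in> {1, 3} then - 1 else 1 :: real"
  have sum_power: "E (op_power (G f + G g) (n + 1)) = (\<Sum>\<sigma>\<in>partitions (n + 1).
      complex_of_real (q ^ rc \<sigma>) * (\<Prod>B\<in>\<sigma>. 2 * r (card B)))" for n
    using moment [of "n + 1" "\<lambda>i. 1"]
    unfolding op_power_def op_prod_replicate_upt by (simp add: mult.commute del: upt_Suc)
  have word: "(G f - G g) o\<^sub>L (G f + G g) o\<^sub>L (G f - G g) o\<^sub>L op_power (G f + G g) n =
      op_prod (map (\<lambda>i. G f + ?s i *\<^sub>R G g) [1..<n + 3 + 1])" for n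
  proof -
    have "map (\<lambda>i. G f + ?s i *\<^sub>R G g) [4..<n + 4] = replicate n (G f + G g)"
      by (rule nth_equalityI) auto
    moreover have "[1..<n + 3 + 1] = 1 # 2 # 3 # [4..<n + 4]"
      by (simp add: upt_conv_Cons numeral_eq_Suc del: upt_Suc)
    ultimately have "map (\<lambda>i. G f + ?s i *\<^sub>R G g) [1..<n + 3 + 1] =
        (G f - G g) # (G f + G g) # (G f - G g) # replicate n (G f + G g)"
      by simp
    then show ?thesis
      by (simp only: op_power_def op_prod_Cons) (rule blinfun_eqI, simp)
  qed
  have "E ((G f - G g) o\<^sub>L (G f + G g) o\<^sub>L (G f - G g) o\<^sub>L op_power (G f + G g) n) =
      2 * complex_of_real q * E (op_power (G f + G g) (n + 1)) +
      (\<Sum>\<sigma>\<in>large_first_third n. complex_of_real (q ^ rc \<sigma>) * (\<Prod>B\<in>\<sigma>. 2 * r (card B)))" for n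
    unfolding word sum_power using moment [of "n + 3" ?s] sum_signed_weights [OF r12, of q n]
    by simp
  \<comment> \<open>After cancelling the common term, the identity for \<open>n\<close> says
    precisely that the sum over \<open>large_first_third n\<close> vanishes.\<close>
  then have "(\<forall>n. E ((G f - G g) o\<^sub>L (G f + G g) o\<^sub>L (G f - G g) o\<^sub>L op_power (G f + G g) n) =
              2 * complex_of_real q * E (op_power (G f + G g) (n + 1)))
         \<longleftrightarrow> (\<forall>k\<ge>3. r k = 0)"
    using sum_large_first_third_eq_0_iff [of q r] by simp
  also have "\<dots> \<longleftrightarrow> q_gaussian q E G {f, g}"
    using fg generators r12
    by (intro q_gaussian_iff_cumulants [symmetric, OF _ _ _ _ independent r])
      (auto simp: inner_commute)
  finally show ?thesis .
qed

end
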